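(* Let $\tau>0$. For $\mu\in\mathbb R$ and $\varepsilon>0$ we have $$\mathbb P\left\{\mathrm{Sch}_\tau[\mu,\mu+\varepsilon]\ge2\right\}\le4\exp\left(-\frac{(\log(\tau/\varepsilon)-\tau)^2}{\tau}\right)$$ whenever $\log(\tau/\varepsilon)-\tau\ge0$.
   Context: Let $\mathcal B,\mathcal B_2,\mathcal B_3$ be independent standard real Brownian motions, $\mathcal W=\frac1{\sqrt2}(\mathcal B_2+i\mathcal B_3)$, and let $\varphi^\lambda(t)$, $\lambda\in\mathbb R$, be the solutions, all driven by the same $\mathcal B,\mathcal W$, of $d\varphi^\lambda=\lambda\,dt+d\mathcal B+\mathrm{Re}[e^{-i\varphi^\lambda}d\mathcal W]$, $\varphi^\lambda(0)=0$ (in the version for which $\lambda\mapsto\varphi^\lambda(t)$ is strictly increasing and real-analytic for $t>0$). $\mathrm{Sch}_\tau=\{\lambda\in\mathbb R:\varphi^{\lambda/\tau}(\tau)\in2\pi\mathbb Z\}$, and $\mathrm{Sch}_\tau[a,b]$ denotes the number of points of $\mathrm{Sch}_\tau$ in $[a,b]$. *)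

theory Defs
  imports "HOL-Probability.Probability"
begin

(* All processes are functions of time and sample point; only times t >= 0 carry meaning. *)

definition standard_brownian_motion :: "'w measure \<Rightarrow> (real \<Rightarrow> 'w \<Rightarrow> real) \<Rightarrow> bool" where
  "standard_brownian_motion M X \<longleftrightarrow>
     (\<forall>t\<ge>0. X t \<in> borel_measurable M) \<and>
     (AE \<omega> in M. X 0 \<omega> = 0) \<and>
     (\<forall>n::nat. \<forall>p::nat \<Rightarrow> real. 0 \<le> p 0 \<and> (\<forall>i<n. p i \<le> p (Suc i)) \<longrightarrow>
        prob_space.indep_vars M (\<lambda>_. borel) (\<lambda>i \<omega>. X (p (Suc i)) \<omega> - X (p i) \<omega>) {..<n}) \<and>
     (\<forall>s t. 0 \<le> s \<and> s < t \<longrightarrow>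
        distributed M lborel (\<lambda>\<omega>. X t \<omega> - X s \<omega>) (normal_density 0 (sqrt (t - s)))) \<and>
     (AE \<omega> in M. continuous_on {0..} (\<lambda>t. X t \<omega>))"

(* Independence of whole processes: each process is one random element of the product space
   of real-valued functions on [0,\<infinity>). *)
definition independent_processes :: "'w measure \<Rightarrow> (real \<Rightarrow> 'w \<Rightarrow> real) list \<Rightarrow> bool" where
  "independent_processes M Xs \<longleftrightarrow>
     prob_space.indep_vars M (\<lambda>_. Pi\<^sub>M {0..} (\<lambda>_. borel))
       (\<lambda>i \<omega>. \<lambda>t\<in>{0..}. (Xs ! i) t \<omega>) {..<length Xs}"

(* F is a filtration to which X, Y, Z are adapted and whose past is independent of the future
   increments of (X, Y, Z). For independent Brownian motions the natural filtration and its
   augmentation by null sets are examples. The library's filtrations are here indexed by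
   all reals; the values at negative times play no role (take F t = F 0 there). *)
definition brownian_filtration ::
  "'w measure \<Rightarrow> (real \<Rightarrow> 'w measure) \<Rightarrow> (real \<Rightarrow> 'w \<Rightarrow> real) \<Rightarrow> (real \<Rightarrow> 'w \<Rightarrow> real)
    \<Rightarrow> (real \<Rightarrow> 'w \<Rightarrow> real) \<Rightarrow> bool" where
  "brownian_filtration M F X Y Z \<longleftrightarrow>
     filtration (space M) F \<and>
     (\<forall>t\<ge>0. subalgebra M (F t)) \<and>
     (\<forall>t\<ge>0. X t \<in> borel_measurable (F t) \<and> Y t \<in> borel_measurable (F t) \<and>
              Z t \<in> borel_measurable (F t)) \<and>
     (\<forall>s t. 0 \<le> s \<and> s \<le> t \<longrightarrow>
        prob_space.indep_set M (sets (F s))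
          (sets (vimage_algebra (space M)
             (\<lambda>\<omega>. (X t \<omega> - X s \<omega>, Y t \<omega> - Y s \<omega>, Z t \<omega> - Z s \<omega>)) borel)))"

(* The Ito integral over [0,t], constructed as usual: simple processes, then L2 limits.
   The simple process given by (n, p, \<xi>) equals \<xi> i on [p i, p (i+1)). *)
definition simple_process ::
  "'w measure \<Rightarrow> (real \<Rightarrow> 'w measure) \<Rightarrow> real \<Rightarrow> nat \<Rightarrow> (nat \<Rightarrow> real) \<Rightarrow> (nat \<Rightarrow> 'w \<Rightarrow> complex) \<Rightarrow> bool"
  where
  "simple_process M F t n p \<xi> \<longleftrightarrow>
     p 0 = 0 \<and> p n = t \<and> (\<forall>i<n. p i \<le> p (Suc i)) \<and>
     (\<forall>i<n. \<xi> i \<in> borel_measurable (F (p i))) \<and>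
     (\<exists>C. \<forall>i<n. \<forall>\<omega>\<in>space M. norm (\<xi> i \<omega>) \<le> C)"

definition simple_value ::
  "nat \<Rightarrow> (nat \<Rightarrow> real) \<Rightarrow> (nat \<Rightarrow> 'w \<Rightarrow> complex) \<Rightarrow> real \<Rightarrow> 'w \<Rightarrow> complex" where
  "simple_value n p \<xi> s \<omega> = (\<Sum>i<n. indicator {p i..<p (Suc i)} s * \<xi> i \<omega>)"

definition simple_integral ::
  "nat \<Rightarrow> (nat \<Rightarrow> real) \<Rightarrow> (nat \<Rightarrow> 'w \<Rightarrow> complex) \<Rightarrow> (real \<Rightarrow> 'w \<Rightarrow> complex) \<Rightarrow> 'w \<Rightarrow> complex" where
  "simple_integral n p \<xi> W \<omega> = (\<Sum>i<n. \<xi> i \<omega> * (W (p (Suc i)) \<omega> - W (p i) \<omega>))"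

definition ito_integrand ::
  "'w measure \<Rightarrow> (real \<Rightarrow> 'w measure) \<Rightarrow> real \<Rightarrow> (real \<Rightarrow> 'w \<Rightarrow> complex) \<Rightarrow> bool" where
  "ito_integrand M F t H \<longleftrightarrow>
     (\<lambda>(s, \<omega>). H s \<omega>) \<in> borel_measurable (restrict_space borel {0..t} \<Otimes>\<^sub>M M) \<and>
     (\<forall>s\<in>{0..t}. H s \<in> borel_measurable (F s)) \<and>
     (\<integral>\<^sup>+\<omega>. (\<integral>\<^sup>+s\<in>{0..t}. ennreal ((norm (H s \<omega>))\<^sup>2) \<partial>lborel) \<partial>M) < \<infinity>"

(* J is (a version of) the integral of H dW over [0,t]. *)
definition has_ito_integral ::
  "'w measure \<Rightarrow> (real \<Rightarrow> 'w measure) \<Rightarrow> (real \<Rightarrow> 'w \<Rightarrow> complex) \<Rightarrow> real \<Rightarrow> (real \<Rightarrow> 'w \<Rightarrow> complex)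
    \<Rightarrow> ('w \<Rightarrow> complex) \<Rightarrow> bool" where
  "has_ito_integral M F W t H J \<longleftrightarrow>
     ito_integrand M F t H \<and> J \<in> borel_measurable M \<and>
     (\<exists>n p \<xi>.
        (\<forall>k::nat. simple_process M F t (n k) (p k) (\<xi> k)) \<and>
        (\<lambda>k. \<integral>\<^sup>+\<omega>. (\<integral>\<^sup>+s\<in>{0..t}.
              ennreal ((norm (simple_value (n k) (p k) (\<xi> k) s \<omega> - H s \<omega>))\<^sup>2) \<partial>lborel) \<partial>M)
          \<longlonglongrightarrow> 0 \<and>
        (\<lambda>k. \<integral>\<^sup>+\<omega>. ennreal ((norm (simple_integral (n k) (p k) (\<xi> k) W \<omega> - J \<omega>))\<^sup>2) \<partial>M)
          \<longlonglongrightarrow> 0)"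

definition complex_noise ::
  "(real \<Rightarrow> 'w \<Rightarrow> real) \<Rightarrow> (real \<Rightarrow> 'w \<Rightarrow> real) \<Rightarrow> real \<Rightarrow> 'w \<Rightarrow> complex" where
  "complex_noise B2 B3 t \<omega> =
     (complex_of_real (B2 t \<omega>) + \<i> * complex_of_real (B3 t \<omega>)) / complex_of_real (sqrt 2)"

(* \<theta> solves d\<theta> = \<kappa> dt + dB + Re (exp(-i \<theta>) dW), \<theta>(0) = 0, in integrated form. *)
definition phase_solution ::
  "'w measure \<Rightarrow> (real \<Rightarrow> 'w measure) \<Rightarrow> (real \<Rightarrow> 'w \<Rightarrow> real) \<Rightarrow> (real \<Rightarrow> 'w \<Rightarrow> complex) \<Rightarrow> real
    \<Rightarrow> (real \<Rightarrow> 'w \<Rightarrow> real) \<Rightarrow> bool" where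
  "phase_solution M F B W \<kappa> \<theta> \<longleftrightarrow>
     (\<forall>t\<ge>0. \<theta> t \<in> borel_measurable (F t)) \<and>
     (AE \<omega> in M. continuous_on {0..} (\<lambda>t. \<theta> t \<omega>)) \<and>
     (AE \<omega> in M. \<theta> 0 \<omega> = 0) \<and>
     (\<forall>t\<ge>0. \<exists>J. has_ito_integral M F W t (\<lambda>s \<omega>. exp (- \<i> * complex_of_real (\<theta> s \<omega>))) J \<and>
        (AE \<omega> in M. \<theta> t \<omega> = \<kappa> * t + B t \<omega> + Re (J \<omega>)))"

definition real_analytic_on :: "(real \<Rightarrow> real) \<Rightarrow> real set \<Rightarrow> bool" where
  "real_analytic_on f S \<longleftrightarrow>
     (\<forall>x\<in>S. \<exists>r>0. \<exists>a. \<forall>y. \<bar>y - x\<bar> < r \<longrightarrow> (\<lambda>n. a n * (y - x) ^ n) sums f y)"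

definition Sch :: "(real \<Rightarrow> real \<Rightarrow> 'w \<Rightarrow> real) \<Rightarrow> real \<Rightarrow> 'w \<Rightarrow> real set" where
  "Sch \<phi> \<tau> \<omega> = {l. \<exists>k::int. \<phi> (l / \<tau>) \<tau> \<omega> = 2 * pi * of_int k}"

(* Counting measure rather than card: the count of an infinite set is \<infinity>, not 0. *)
definition Sch_count ::
  "(real \<Rightarrow> real \<Rightarrow> 'w \<Rightarrow> real) \<Rightarrow> real \<Rightarrow> 'w \<Rightarrow> real \<Rightarrow> real \<Rightarrow> ennreal" where
  "Sch_count \<phi> \<tau> \<omega> a b = emeasure (count_space UNIV) (Sch \<phi> \<tau> \<omega> \<inter> {a..b})"

(* The event that [a,b] contains at least two points. When \<phi> is regular only almost surely, this
   set is an event up to a null set, so its probability is taken in the completion of M. *)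
definition two_points_event ::
  "'w measure \<Rightarrow> (real \<Rightarrow> real \<Rightarrow> 'w \<Rightarrow> real) \<Rightarrow> real \<Rightarrow> real \<Rightarrow> real \<Rightarrow> 'w set" where
  "two_points_event M \<phi> \<tau> a b = {\<omega> \<in> space M. Sch_count \<phi> \<tau> \<omega> a b \<ge> 2}"

end

theory Submission
  imports Defs
begin

text \<open>
Write \<open>\<delta> = \<epsilon> / \<tau>\<close> and let \<open>x t\<close> be the difference of the phases at \<open>(\<mu> + \<epsilon>) / \<tau>\<close> and at
\<open>\<mu> / \<tau>\<close>. Because the phase is increasing in the spectral parameter, two points of the process in
\<open>[\<mu>, \<mu> + \<epsilon>]\<close> are two different multiples of \<open>2 * pi\<close> between the two phases at time \<open>\<tau>\<close>, so they
force \<open>x \<tau> \<ge> 2 * pi\<close>. The real noise cancels in the difference, and \<open>x\<close> solves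
\<open>dx = \<delta> dt + Re ((exp (- \<i> \<phi>2) - exp (- \<i> \<phi>1)) dW)\<close>. Since
\<open>\<bar>exp (- \<i> \<phi>2) - exp (- \<i> \<phi>1)\<bar>\<^sup>2 = 4 * (sin (x / 2))\<^sup>2\<close> and \<open>W\<close> is isotropic, the generator of \<open>x\<close> is
\<open>\<delta> g' + (sin (x / 2))\<^sup>2 g''\<close>, whose diffusion coefficient is at most \<open>x\<^sup>2 / 4\<close>: up to the drift, \<open>x\<close> grows no
faster than a geometric Brownian motion started at height about \<open>\<delta>\<close>.

The bound is therefore a moment bound. If a bounded smooth \<open>g \<ge> 0\<close> satisfies
\<open>\<delta> g' + z g'' \<le> c g\<close> for all \<open>0 \<le> z \<le> x\<^sup>2 / 4\<close>, then \<open>E g (x \<tau>) \<le> exp (c * \<tau>) * g 0\<close>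
(\<open>dynkin_inequality\<close>). Apply this to \<open>(q / (1 + q / 2)) powr (a / 2)\<close> with \<open>q = x\<^sup>2 + \<delta>\<^sup>2\<close>: it behaves
like \<open>\<bar>x\<bar> powr a\<close> between \<open>\<delta>\<close> and 1, is at most \<open>\<delta> powr a\<close> at 0, at least 1 beyond \<open>2 * pi\<close>, and admits the rate
\<open>c = a\<^sup>2 / 4 + a\<close> (\<open>saturated_power_test_function\<close>). By Markov's inequality the probability is at most
\<open>exp ((a\<^sup>2 / 4 + a) * \<tau> - a * L)\<close> with \<open>L = ln (\<tau> / \<epsilon>)\<close>, and the minimiser \<open>a = 2 * (L - \<tau>) / \<tau>\<close>, which is
nonnegative by hypothesis, gives \<open>exp (- (L - \<tau>)\<^sup>2 / \<tau>)\<close>.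

The Dynkin inequality is proved without Ito's formula. The isometry for simple integrands
(\<open>isometry\<close>) shows that the stochastic integrals are \<open>L\<^sup>2\<close> limits of left-endpoint sums on uniform
grids (\<open>ito_integral_simple_error\<close>, \<open>sq_dist_grid_tendsto\<close>). Along such a sum every increment is
independent of the past with explicit second and fourth moments, so a third-order Taylor expansion of
\<open>g\<close> bounds one step (\<open>expectation_one_step\<close>). With step length \<open>h\<close> the errors of a step are \<open>o(h)\<close>, and
they vanish after summation.
\<close>

section \<open>Isotropic complex noise and its isometry\<close>

lemma borel_measurable_cnj [measurable]: "cnj \<in> borel_measurable borel"
  by (intro borel_measurable_continuous_onI continuous_intros)

text \<open>The properties of \<open>W = (B2 + \<i> * B3) / sqrt 2\<close> on which the argument rests. The vanishing of the
  pseudo-variance \<open>E (W t - W s)\<^sup>2\<close> is the isotropy: it makes the variance of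
  \<open>Re (z * (W t - W s))\<close> equal to \<open>\<bar>z\<bar>\<^sup>2 * (t - s) / 2\<close> whatever the argument of \<open>z\<close>.\<close>

locale isotropic_noise = prob_space M for M :: "'w measure" +
  fixes F :: "real \<Rightarrow> 'w measure" and W :: "real \<Rightarrow> 'w \<Rightarrow> complex"
  assumes subalgebra_F: "0 \<le> t \<Longrightarrow> subalgebra M (F t)"
    and F_mono: "0 \<le> s \<Longrightarrow> s \<le> t \<Longrightarrow> subalgebra (F t) (F s)"
    and adapted: "0 \<le> t \<Longrightarrow> W t \<in> borel_measurable (F t)"
    and increment_indep: "0 \<le> s \<Longrightarrow> s \<le> t \<Longrightarrow>
      indep_set (sets (F s)) (sets (vimage_algebra (space M) (\<lambda>\<omega>. W t \<omega> - W s \<omega>) borel))"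
    and increment_mean: "0 \<le> s \<Longrightarrow> s \<le> t \<Longrightarrow>
      has_bochner_integral M (\<lambda>\<omega>. W t \<omega> - W s \<omega>) 0"
    and increment_variance: "0 \<le> s \<Longrightarrow> s \<le> t \<Longrightarrow>
      has_bochner_integral M (\<lambda>\<omega>. (W t \<omega> - W s \<omega>) * cnj (W t \<omega> - W s \<omega>)) (of_real (t - s))"
    and increment_pseudo_variance: "0 \<le> s \<Longrightarrow> s \<le> t \<Longrightarrow>
      has_bochner_integral M (\<lambda>\<omega>. (W t \<omega> - W s \<omega>)\<^sup>2) 0"
    and increment_fourth_moment: "0 \<le> s \<Longrightarrow> s \<le> t \<Longrightarrow>
      integrable M (\<lambda>\<omega>. norm (W t \<omega> - W s \<omega>) ^ 4) \<and>
      expectation (\<lambda>\<omega>. norm (W t \<omega> - W s \<omega>) ^ 4) \<le> 3 * (t - s)\<^sup>2"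
begin

abbreviation inc :: "real \<Rightarrow> real \<Rightarrow> 'w \<Rightarrow> complex" where
  "inc s t \<omega> \<equiv> W t \<omega> - W s \<omega>"

lemma F_measurable_M: "0 \<le> t \<Longrightarrow> f \<in> measurable (F t) N \<Longrightarrow> f \<in> measurable M N"
  using measurable_from_subalg subalgebra_F by blast

lemma F_measurable_mono:
  "0 \<le> s \<Longrightarrow> s \<le> t \<Longrightarrow> f \<in> measurable (F s) N \<Longrightarrow> f \<in> measurable (F t) N"
  using measurable_from_subalg F_mono by blast

lemma inc_measurable_F: "0 \<le> s \<Longrightarrow> s \<le> t \<Longrightarrow> inc s t \<in> borel_measurable (F t)"
  using adapted[of t] F_measurable_mono[OF _ _ adapted, of s t] by simp

lemma inc_measurable: "0 \<le> s \<Longrightarrow> s \<le> t \<Longrightarrow> inc s t \<in> borel_measurable M"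
  by (rule F_measurable_M[OF _ inc_measurable_F]) auto

lemma indep_var_past_increment:
  fixes Z :: "'w \<Rightarrow> complex"
  assumes "0 \<le> s" "s \<le> t" "Z \<in> borel_measurable (F s)"
  shows "indep_var borel Z borel (inc s t)"
  unfolding indep_var_eq
proof (intro conjI)
  show Z: "random_variable borel Z"
    using F_measurable_M assms by blast
  show "random_variable borel (inc s t)"
    using inc_measurable assms by blast
  have sp: "space (F s) = space M"
    using subalgebra_F[of s] assms by (simp add: subalgebra_def)
  have "sigma_sets (space M) {Z -` A \<inter> space M |A. A \<in> sets borel} \<subseteq> sets (F s)"
    using measurable_sets[OF assms(3)] sp
    by (intro sets.sigma_sets_subset[of _ "F s", unfolded sp]) auto
  then show "indep_set (sigma_sets (space M) {Z -` A \<inter> space M |A. A \<in> sets borel})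
     (sigma_sets (space M) {inc s t -` A \<inter> space M |A. A \<in> sets borel})"
    using increment_indep[OF assms(1,2)]
    unfolding indep_sets2_eq sets_vimage_algebra by blast
qed

text \<open>Independence turns the expectation into a product. The function \<open>f\<close> picks the moment of the
  increment: the identity, its conjugate, \<open>x * cnj x\<close> or \<open>x\<^sup>2\<close>.\<close>

lemma past_times_increment:
  fixes Z :: "'w \<Rightarrow> complex" and f :: "complex \<Rightarrow> complex"
  assumes "0 \<le> s" "s \<le> t" "Z \<in> borel_measurable (F s)" "integrable M Z"
    and "f \<in> borel_measurable borel" "has_bochner_integral M (\<lambda>\<omega>. f (inc s t \<omega>)) m"
  shows "has_bochner_integral M (\<lambda>\<omega>. Z \<omega> * f (inc s t \<omega>)) (expectation Z * m)"
proof -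
  have *: "indep_var borel Z borel (\<lambda>\<omega>. f (inc s t \<omega>))"
    using indep_var_compose[OF indep_var_past_increment[OF assms(1-3)], of id borel f borel] assms(5)
    by (simp add: comp_def)
  have "integrable M (\<lambda>\<omega>. f (inc s t \<omega>))" "expectation (\<lambda>\<omega>. f (inc s t \<omega>)) = m"
    using assms(6) by (auto simp: has_bochner_integral_iff)
  with indep_var_lebesgue_integral[OF * assms(4)] indep_var_integrable[OF * assms(4)]
  show ?thesis by (simp add: has_bochner_integral_iff)
qed

lemma integrable_mult_bounded:
  fixes f g :: "'w \<Rightarrow> complex"
  assumes "integrable M f" "g \<in> borel_measurable M" "\<And>\<omega>. \<omega> \<in> space M \<Longrightarrow> norm (g \<omega>) \<le> C"
  shows "integrable M (\<lambda>\<omega>. f \<omega> * g \<omega>)"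
proof (rule Bochner_Integration.integrable_bound[where f="\<lambda>\<omega>. C * norm (f \<omega>)"])
  show "AE x in M. norm (f x * g x) \<le> norm (C * norm (f x))"
  proof (rule AE_I2)
    fix x assume x: "x \<in> space M"
    have "norm (f x) * norm (g x) \<le> norm (f x) * C" using assms(3)[OF x] by (intro mult_left_mono) auto
    then show "norm (f x * g x) \<le> norm (C * norm (f x))"
      using assms(3)[OF x] by (simp add: norm_mult abs_mult mult.commute)
         (smt (verit) norm_ge_zero mult_right_mono)
  qed
qed (use assms in auto)

text \<open>Splitting the two increments at the interval endpoints leaves only the common part: every
  other product has a factor that is an increment independent of the rest.\<close>

lemma covariance_ordered:
  fixes \<xi> \<eta> :: "'w \<Rightarrow> complex"
  assumes ab: "0 \<le> a" "a \<le> a'" "a \<le> b" "b \<le> b'"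
    and m: "\<xi> \<in> borel_measurable (F a)" "\<eta> \<in> borel_measurable (F b)"
    and bd: "\<And>\<omega>. \<omega> \<in> space M \<Longrightarrow> norm (\<xi> \<omega>) \<le> C" "\<And>\<omega>. \<omega> \<in> space M \<Longrightarrow> norm (\<eta> \<omega>) \<le> C"
  shows "has_bochner_integral M (\<lambda>\<omega>. (\<xi> \<omega> * inc a a' \<omega>) * cnj (\<eta> \<omega> * inc b b' \<omega>))
    (expectation (\<lambda>\<omega>. \<xi> \<omega> * cnj (\<eta> \<omega>)) * of_real (measure lborel ({a..<a'} \<inter> {b..<b'})))"
proof -
  have b0: "0 \<le> b" using ab by simp
  have mM: "\<xi> \<in> borel_measurable M" "\<eta> \<in> borel_measurable M"
    using F_measurable_M m ab b0 by blast+
  have mb: "\<xi> \<in> borel_measurable (F b)" using F_measurable_mono m ab by blast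
  have int\<xi>: "integrable M \<xi>"
    using mM bd by (intro integrable_const_bound[where B=C]) auto
  have int: "integrable M (\<lambda>\<omega>. \<xi> \<omega> * cnj (\<eta> \<omega>))"
    using mM bd by (intro integrable_mult_bounded[OF int\<xi>]) auto
  have cnj_mean: "has_bochner_integral M (\<lambda>\<omega>. cnj (inc s t \<omega>)) 0" if "0 \<le> s" "s \<le> t" for s t
    using has_bochner_integral_bounded_linear[OF bounded_linear_cnj increment_mean[OF that]] by simp
  have past: "integrable M (\<lambda>\<omega>. \<xi> \<omega> * inc a c \<omega> * cnj (\<eta> \<omega>))" if "a \<le> c" for c
    using past_times_increment[OF ab(1) that m(1) int\<xi>, of "\<lambda>x. x"] increment_mean[OF ab(1) that] mM bd
    by (intro integrable_mult_bounded[of "\<lambda>\<omega>. \<xi> \<omega> * inc a c \<omega>" "\<lambda>\<omega>. cnj (\<eta> \<omega>)" C])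
       (auto simp: has_bochner_integral_iff)
  show ?thesis
  proof (cases "a' \<le> b")
    case True
    have e: "{a..<a'} \<inter> {b..<b'} = {}" using True by auto
    have "(\<lambda>\<omega>. \<xi> \<omega> * inc a a' \<omega> * cnj (\<eta> \<omega>)) \<in> borel_measurable (F b)"
      using mb m(2) F_measurable_mono[OF _ True inc_measurable_F] ab by auto
    from past_times_increment[OF b0 ab(4) this past[OF ab(2)] _ cnj_mean[OF b0 ab(4)]]
    show ?thesis unfolding e by (simp add: mult_ac)
  next
    case False
    have m1: "(\<lambda>\<omega>. \<xi> \<omega> * inc a b \<omega> * cnj (\<eta> \<omega>)) \<in> borel_measurable (F b)"
      using mb m(2) inc_measurable_F ab by auto
    have t1: "has_bochner_integral M (\<lambda>\<omega>. \<xi> \<omega> * inc a b \<omega> * cnj (\<eta> \<omega>) * cnj (inc b b' \<omega>)) 0"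
      using past_times_increment[OF b0 ab(4) m1 past[OF ab(3)] _ cnj_mean[OF b0 ab(4)]] by simp
    have m2: "(\<lambda>\<omega>. \<xi> \<omega> * cnj (\<eta> \<omega>)) \<in> borel_measurable (F b)" using mb m(2) by auto
    have t2: "has_bochner_integral M (\<lambda>\<omega>. \<xi> \<omega> * cnj (\<eta> \<omega>) * (inc b c \<omega> * cnj (inc b c \<omega>)))
        (expectation (\<lambda>\<omega>. \<xi> \<omega> * cnj (\<eta> \<omega>)) * of_real (c - b))" if "b \<le> c" for c
      by (rule past_times_increment[OF b0 that m2 int, of "\<lambda>x. x * cnj x"])
         (use increment_variance[OF b0 that] in auto)
    have m3: "(\<lambda>\<omega>. \<xi> \<omega> * cnj (\<eta> \<omega>) * inc b c \<omega>) \<in> borel_measurable (F c)" if "b \<le> c" for c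
      using F_measurable_mono[OF b0 that m2] inc_measurable_F[OF b0 that] by auto
    have i3: "integrable M (\<lambda>\<omega>. \<xi> \<omega> * cnj (\<eta> \<omega>) * inc b c \<omega>)" if "b \<le> c" for c
      using past_times_increment[OF b0 that m2 int, of "\<lambda>x. x"] increment_mean[OF b0 that]
      by (auto simp: has_bochner_integral_iff)
    have m4: "(\<lambda>\<omega>. \<xi> \<omega> * cnj (\<eta> \<omega>) * cnj (inc b c \<omega>)) \<in> borel_measurable (F c)" if "b \<le> c" for c
      by (intro borel_measurable_times F_measurable_mono[OF b0 that m2]
            measurable_compose[OF inc_measurable_F[OF b0 that]]) simp
    have i4: "integrable M (\<lambda>\<omega>. \<xi> \<omega> * cnj (\<eta> \<omega>) * cnj (inc b c \<omega>))" if "b \<le> c" for c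
      using past_times_increment[OF b0 that m2 int _ cnj_mean[OF b0 that]]
      by (auto simp: has_bochner_integral_iff)
    show ?thesis
    proof (cases "a' \<le> b'")
      case True
      have e: "{a..<a'} \<inter> {b..<b'} = {b..<a'}" using True ab by auto
      have c: "b \<le> a'" "0 \<le> a'" using False ab by auto
      have "has_bochner_integral M (\<lambda>\<omega>. \<xi> \<omega> * cnj (\<eta> \<omega>) * inc b a' \<omega> * cnj (inc a' b' \<omega>)) 0"
        using past_times_increment[OF c(2) True m3[OF c(1)] i3[OF c(1)] _ cnj_mean[OF c(2) True]]
        by simp
      from has_bochner_integral_add[OF has_bochner_integral_add[OF t1 t2[OF c(1)]] this]
      show ?thesis unfolding e using c by (simp add: algebra_simps)
    next
      case F: False
      have e: "{a..<a'} \<inter> {b..<b'} = {b..<b'}" using F ab by auto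
      have c: "b' \<le> a'" "0 \<le> b'" using F ab by auto
      have "has_bochner_integral M (\<lambda>\<omega>. \<xi> \<omega> * cnj (\<eta> \<omega>) * cnj (inc b b' \<omega>) * inc b' a' \<omega>) 0"
        using past_times_increment[where f="\<lambda>x. x", OF c(2,1) m4[OF ab(4)] i4[OF ab(4)] _
            increment_mean[OF c(2,1)]] by simp
      from has_bochner_integral_add[OF has_bochner_integral_add[OF t1 t2[OF ab(4)]] this]
      show ?thesis unfolding e using ab by (simp add: algebra_simps)
    qed
  qed
qed

lemma covariance:
  fixes \<xi> \<eta> :: "'w \<Rightarrow> complex"
  assumes ab: "0 \<le> a" "a \<le> a'" "0 \<le> b" "b \<le> b'"
    and m: "\<xi> \<in> borel_measurable (F a)" "\<eta> \<in> borel_measurable (F b)"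
    and bd: "\<And>\<omega>. \<omega> \<in> space M \<Longrightarrow> norm (\<xi> \<omega>) \<le> C" "\<And>\<omega>. \<omega> \<in> space M \<Longrightarrow> norm (\<eta> \<omega>) \<le> C"
  shows "has_bochner_integral M (\<lambda>\<omega>. (\<xi> \<omega> * inc a a' \<omega>) * cnj (\<eta> \<omega> * inc b b' \<omega>))
    (expectation (\<lambda>\<omega>. \<xi> \<omega> * cnj (\<eta> \<omega>)) * of_real (measure lborel ({a..<a'} \<inter> {b..<b'})))"
proof (cases "a \<le> b")
  case True
  then show ?thesis using covariance_ordered[OF ab(1,2) True ab(4) m bd] by simp
next
  case False
  then have "b \<le> a" by simp
  note covariance_ordered[OF ab(3,4) this ab(2) m(2,1) bd(2,1)]
  from has_bochner_integral_bounded_linear[OF bounded_linear_cnj this]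
  have *: "has_bochner_integral M (\<lambda>\<omega>. (\<xi> \<omega> * inc a a' \<omega>) * cnj (\<eta> \<omega> * inc b b' \<omega>))
    (cnj (expectation (\<lambda>\<omega>. \<eta> \<omega> * cnj (\<xi> \<omega>))) * of_real (measure lborel ({b..<b'} \<inter> {a..<a'})))"
    by (simp add: mult_ac)
  have "cnj (expectation (\<lambda>\<omega>. \<eta> \<omega> * cnj (\<xi> \<omega>))) = expectation (\<lambda>\<omega>. \<xi> \<omega> * cnj (\<eta> \<omega>))"
    by (simp add: mult.commute flip: Bochner_Integration.integral_cnj)
  with * show ?thesis by (simp add: Int_commute)
qed

text \<open>The intervals may overlap and need not form a partition. So the difference of two
  simple integrals over unrelated partitions is again of this form (the two families are put side by
  side), and no common refinement is required. Both sides equal the sum over pairs \<open>k, l\<close> of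
  \<open>E (\<zeta> k * cnj (\<zeta> l))\<close> times the length of the overlap of the two intervals.\<close>

lemma isometry:
  fixes a a' :: "'i \<Rightarrow> real" and \<zeta> :: "'i \<Rightarrow> 'w \<Rightarrow> complex"
  assumes "finite K" and a: "\<And>k. k \<in> K \<Longrightarrow> 0 \<le> a k" "\<And>k. k \<in> K \<Longrightarrow> a k \<le> a' k"
    and m: "\<And>k. k \<in> K \<Longrightarrow> \<zeta> k \<in> borel_measurable (F (a k))"
    and bd: "\<And>k \<omega>. k \<in> K \<Longrightarrow> \<omega> \<in> space M \<Longrightarrow> norm (\<zeta> k \<omega>) \<le> C"
  shows "(\<integral>\<^sup>+\<omega>. ennreal ((norm (\<Sum>k\<in>K. \<zeta> k \<omega> * inc (a k) (a' k) \<omega>))\<^sup>2) \<partial>M) =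
    (\<integral>\<^sup>+\<omega>. (\<integral>\<^sup>+s. ennreal ((norm (\<Sum>k\<in>K. indicator {a k..<a' k} s * \<zeta> k \<omega>))\<^sup>2) \<partial>lborel) \<partial>M)"
proof -
  define c where "c k l = measure lborel ({a k..<a' k} \<inter> {a l..<a' l})" for k l
  define S where "S \<omega> = (\<Sum>k\<in>K. \<zeta> k \<omega> * inc (a k) (a' k) \<omega>)" for \<omega>
  define v where "v s \<omega> = (\<Sum>k\<in>K. indicator {a k..<a' k} s * \<zeta> k \<omega>)" for s \<omega>
  define Q where "Q \<omega> = (\<Sum>k\<in>K. \<Sum>l\<in>K. \<zeta> k \<omega> * cnj (\<zeta> l \<omega>) * of_real (c k l))" for \<omega>
  have mM: "\<zeta> k \<in> borel_measurable M" if "k \<in> K" for k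
    using F_measurable_M[OF a(1)[OF that] m[OF that]] .
  have int1: "integrable M (\<zeta> k)" if "k \<in> K" for k
    using mM that bd by (intro integrable_const_bound[where B=C]) auto
  have int: "integrable M (\<lambda>\<omega>. \<zeta> k \<omega> * cnj (\<zeta> l \<omega>))" if "k \<in> K" "l \<in> K" for k l
    using mM that bd by (intro integrable_mult_bounded[OF int1[OF that(1)]]) auto
  have SS: "S \<omega> * cnj (S \<omega>) = (\<Sum>k\<in>K. \<Sum>l\<in>K.
      (\<zeta> k \<omega> * inc (a k) (a' k) \<omega>) * cnj (\<zeta> l \<omega> * inc (a l) (a' l) \<omega>))" for \<omega>
    unfolding S_def by (simp add: sum_product cnj_sum)
  have "has_bochner_integral M (\<lambda>\<omega>. S \<omega> * cnj (S \<omega>))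
     (\<Sum>k\<in>K. \<Sum>l\<in>K. expectation (\<lambda>\<omega>. \<zeta> k \<omega> * cnj (\<zeta> l \<omega>)) * of_real (c k l))"
    unfolding SS c_def by (intro has_bochner_integral_sum covariance[where C=C] a m bd)
  moreover have Q: "has_bochner_integral M Q
     (\<Sum>k\<in>K. \<Sum>l\<in>K. expectation (\<lambda>\<omega>. \<zeta> k \<omega> * cnj (\<zeta> l \<omega>)) * of_real (c k l))"
    unfolding Q_def
    by (intro has_bochner_integral_sum has_bochner_integral_mult_left has_bochner_integral_integrable int)
  moreover have "S \<omega> * cnj (S \<omega>) = of_real ((norm (S \<omega>))\<^sup>2)" for \<omega>
    by (rule complex_norm_square[symmetric])
  ultimately have N: "has_bochner_integral M (\<lambda>\<omega>. (norm (S \<omega>))\<^sup>2) (Re (expectation Q))"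
    using has_bochner_integral_bounded_linear[OF bounded_linear_Re, where f="\<lambda>\<omega>. S \<omega> * cnj (S \<omega>)"]
    by (simp add: has_bochner_integral_iff)
  have R: "has_bochner_integral lborel (\<lambda>s. (norm (v s \<omega>))\<^sup>2) (Re (Q \<omega>))" for \<omega>
  proof -
    have vv: "v s \<omega> * cnj (v s \<omega>) = (\<Sum>k\<in>K. \<Sum>l\<in>K. \<zeta> k \<omega> * cnj (\<zeta> l \<omega>) *
        of_real (indicator ({a k..<a' k} \<inter> {a l..<a' l}) s))" for s
      unfolding v_def sum_product cnj_sum
      by (intro sum.cong refl) (auto split: split_indicator)
    have ind: "has_bochner_integral lborel
        (\<lambda>s. of_real (indicator ({a k..<a' k} \<inter> {a l..<a' l}) s) :: complex) (of_real (c k l))" for k l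
      unfolding c_def 
      by (intro has_bochner_integral_of_real has_bochner_integral_real_indicator)
         (auto simp: emeasure_lborel_Icc_eq intro: le_less_trans[OF emeasure_mono[of _ "{a k..a' k}"]])
    have "has_bochner_integral lborel (\<lambda>s. v s \<omega> * cnj (v s \<omega>)) (Q \<omega>)"
      unfolding vv Q_def by (intro has_bochner_integral_sum has_bochner_integral_mult_right ind)
    moreover have "v s \<omega> * cnj (v s \<omega>) = of_real ((norm (v s \<omega>))\<^sup>2)" for s
      by (rule complex_norm_square[symmetric])
    ultimately show ?thesis
      using has_bochner_integral_bounded_linear[OF bounded_linear_Re, where f="\<lambda>s. v s \<omega> * cnj (v s \<omega>)"]
      by simp
  qed
  have R': "(\<integral>\<^sup>+s. ennreal ((norm (v s \<omega>))\<^sup>2) \<partial>lborel) = ennreal (Re (Q \<omega>))"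
    and R0: "0 \<le> Re (Q \<omega>)" for \<omega>
    using R[of \<omega>] nn_integral_eq_integral[of lborel "\<lambda>s. (norm (v s \<omega>))\<^sup>2"]
      integral_nonneg_AE[where M=lborel and f="\<lambda>s. (norm (v s \<omega>))\<^sup>2"]
    by (auto simp: has_bochner_integral_iff)
  have "(\<integral>\<^sup>+\<omega>. ennreal ((norm (S \<omega>))\<^sup>2) \<partial>M) = ennreal (Re (expectation Q))"
    using N nn_integral_eq_integral[of M "\<lambda>\<omega>. (norm (S \<omega>))\<^sup>2"] by (auto simp: has_bochner_integral_iff)
  also have "\<dots> = (\<integral>\<^sup>+\<omega>. ennreal (Re (Q \<omega>)) \<partial>M)"
    using has_bochner_integral_bounded_linear[OF bounded_linear_Re Q] Q R0
      nn_integral_eq_integral[of M "\<lambda>\<omega>. Re (Q \<omega>)"] by (auto simp: has_bochner_integral_iff)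
  finally show ?thesis unfolding R'[symmetric] unfolding S_def v_def .
qed

end

section \<open>Ito integrals\<close>

lemma norm_diff_square_le:
  fixes a b c :: "'a::real_normed_vector"
  shows "ennreal ((norm (a - c))\<^sup>2) \<le> 2 * ennreal ((norm (a - b))\<^sup>2) + 2 * ennreal ((norm (b - c))\<^sup>2)"
proof -
  have "norm (a - c) \<le> norm (a - b) + norm (b - c)"
    using norm_triangle_ineq[of "a - b" "b - c"] by simp
  then have "(norm (a - c))\<^sup>2 \<le> (norm (a - b) + norm (b - c))\<^sup>2"
    by (intro power_mono) auto
  also have "\<dots> \<le> 2 * (norm (a - b))\<^sup>2 + 2 * (norm (b - c))\<^sup>2"
    using sum_squares_bound[of "norm (a - b)" "norm (b - c)"] by (simp add: power2_sum)
  finally have "ennreal ((norm (a - c))\<^sup>2) \<le> ennreal (2 * (norm (a - b))\<^sup>2 + 2 * (norm (b - c))\<^sup>2)"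
    by (rule ennreal_leI)
  then show ?thesis by (simp add: ennreal_mult)
qed

lemma simple_process_partition:
  assumes "simple_process M F t n p \<xi>" "i \<le> n"
  shows "0 \<le> p i" "p i \<le> t"
proof -
  have m: "p i \<le> p (Suc i)" if "i < n" for i using assms that by (auto simp: simple_process_def)
  have le: "i \<le> j \<Longrightarrow> j \<le> n \<Longrightarrow> p i \<le> p j" for i j
  proof (induction j)
    case (Suc j)
    then show ?case using m[of j] by (cases "i = Suc j") auto
  qed simp
  show "0 \<le> p i" "p i \<le> t" using le[of 0 i] le[of i n] assms by (auto simp: simple_process_def)
qed

context isotropic_noise
begin

definition jointly_measurable :: "real \<Rightarrow> (real \<Rightarrow> 'w \<Rightarrow> complex) \<Rightarrow> bool" where
  "jointly_measurable t H \<longleftrightarrow> (\<lambda>(s, \<omega>). H s \<omega>) \<in> borel_measurable (restrict_space borel {0..t} \<Otimes>\<^sub>M M)"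

text \<open>The squared distance of integrands in \<open>L\<^sup>2([0, t] \<times> M)\<close>. It is kept as an iterated integral with
  values in \<open>ennreal\<close>, so that no integrability has to be established beforehand.\<close>

definition sq_dist :: "real \<Rightarrow> (real \<Rightarrow> 'w \<Rightarrow> complex) \<Rightarrow> (real \<Rightarrow> 'w \<Rightarrow> complex) \<Rightarrow> ennreal" where
  "sq_dist t G H = (\<integral>\<^sup>+\<omega>. (\<integral>\<^sup>+s\<in>{0..t}. ennreal ((norm (G s \<omega> - H s \<omega>))\<^sup>2) \<partial>lborel) \<partial>M)"

lemma sq_dist_commute: "sq_dist t G H = sq_dist t H G"
  unfolding sq_dist_def by (simp add: norm_minus_commute)

lemma sq_dist_inner_measurable:
  assumes "jointly_measurable t G" "jointly_measurable t H"
  shows "(\<lambda>\<omega>. \<integral>\<^sup>+s. ennreal ((norm (G s \<omega> - H s \<omega>))\<^sup>2) \<partial>restrict_space lborel {0..t}) \<in> borel_measurable M"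
proof -
  let ?R = "restrict_space lborel {0..t}"
  have s: "sets (?R \<Otimes>\<^sub>M M) = sets (restrict_space borel {0..t} \<Otimes>\<^sub>M M)"
    by (intro sets_pair_measure_cong sets_restrict_space_cong) auto
  have [measurable]: "(\<lambda>(s, \<omega>). G s \<omega>) \<in> borel_measurable (?R \<Otimes>\<^sub>M M)"
      "(\<lambda>(s, \<omega>). H s \<omega>) \<in> borel_measurable (?R \<Otimes>\<^sub>M M)"
    using assms unfolding jointly_measurable_def measurable_cong_sets[OF s refl] by auto
  interpret R: finite_measure ?R
    by (rule finite_measureI) (simp add: emeasure_restrict_space emeasure_lborel_Icc_eq)
  have "(\<lambda>(s, \<omega>). ennreal ((norm (G s \<omega> - H s \<omega>))\<^sup>2)) \<in> borel_measurable (?R \<Otimes>\<^sub>M M)"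
    by measurable
  from measurable_pair_swap[OF this]
  show ?thesis by (intro R.borel_measurable_nn_integral) (simp add: case_prod_beta)
qed

lemma sq_dist_restrict:
  "sq_dist t G H = (\<integral>\<^sup>+\<omega>. (\<integral>\<^sup>+s. ennreal ((norm (G s \<omega> - H s \<omega>))\<^sup>2) \<partial>restrict_space lborel {0..t}) \<partial>M)"
  unfolding sq_dist_def by (subst nn_integral_restrict_space) auto

lemma jointly_measurable_section:
  assumes "jointly_measurable t G" "\<omega> \<in> space M"
  shows "(\<lambda>s. G s \<omega>) \<in> borel_measurable (restrict_space lborel {0..t})"
proof -
  have "(\<lambda>s. case (s, \<omega>) of (s, \<omega>) \<Rightarrow> G s \<omega>) \<in> borel_measurable (restrict_space borel {0..t})"
    by (rule measurable_compose[OF measurable_Pair2' assms(1)[unfolded jointly_measurable_def]])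
       (rule assms(2))
  then show ?thesis
    by (subst measurable_cong_sets[of _ "restrict_space borel {0..t}" _ borel])
       (auto intro!: sets_restrict_space_cong)
qed

text \<open>The parallelogram-type bound \<open>\<bar>a - c\<bar>\<^sup>2 \<le> 2 * \<bar>a - b\<bar>\<^sup>2 + 2 * \<bar>b - c\<bar>\<^sup>2\<close> replaces the triangle
  inequality for norms; the constants are harmless because all distances tend to 0.\<close>

lemma sq_dist_triangle:
  assumes "jointly_measurable t G" "jointly_measurable t H" "jointly_measurable t L"
  shows "sq_dist t G L \<le> 2 * sq_dist t G H + 2 * sq_dist t H L"
proof -
  let ?R = "restrict_space lborel {0..t}"
  note [measurable] = sq_dist_inner_measurable[OF assms(1,2)] sq_dist_inner_measurable[OF assms(2,3)]
  have "(\<integral>\<^sup>+s. ennreal ((norm (G s \<omega> - L s \<omega>))\<^sup>2) \<partial>?R) \<le>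
      2 * (\<integral>\<^sup>+s. ennreal ((norm (G s \<omega> - H s \<omega>))\<^sup>2) \<partial>?R) +
      2 * (\<integral>\<^sup>+s. ennreal ((norm (H s \<omega> - L s \<omega>))\<^sup>2) \<partial>?R)" if "\<omega> \<in> space M" for \<omega>
  proof -
    note [measurable] = assms[THEN jointly_measurable_section, OF that]
    have "(\<integral>\<^sup>+s. ennreal ((norm (G s \<omega> - L s \<omega>))\<^sup>2) \<partial>?R) \<le>
      (\<integral>\<^sup>+s. 2 * ennreal ((norm (G s \<omega> - H s \<omega>))\<^sup>2) + 2 * ennreal ((norm (H s \<omega> - L s \<omega>))\<^sup>2) \<partial>?R)"
      by (intro nn_integral_mono norm_diff_square_le)
    also have "\<dots> = 2 * (\<integral>\<^sup>+s. ennreal ((norm (G s \<omega> - H s \<omega>))\<^sup>2) \<partial>?R) +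
      2 * (\<integral>\<^sup>+s. ennreal ((norm (H s \<omega> - L s \<omega>))\<^sup>2) \<partial>?R)"
      by (subst nn_integral_add) (auto simp: nn_integral_cmult)
    finally show ?thesis .
  qed
  then have "sq_dist t G L \<le> (\<integral>\<^sup>+\<omega>. 2 * (\<integral>\<^sup>+s. ennreal ((norm (G s \<omega> - H s \<omega>))\<^sup>2) \<partial>?R) +
      2 * (\<integral>\<^sup>+s. ennreal ((norm (H s \<omega> - L s \<omega>))\<^sup>2) \<partial>?R) \<partial>M)"
    unfolding sq_dist_restrict by (intro nn_integral_mono)
  also have "\<dots> = 2 * sq_dist t G H + 2 * sq_dist t H L"
    unfolding sq_dist_restrict by (subst nn_integral_add) (auto simp: nn_integral_cmult)
  finally show ?thesis .
qed

lemma simple_process_measurable: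
  assumes "simple_process M F t n p \<xi>" "i < n"
  shows "\<xi> i \<in> borel_measurable M"
  using assms simple_process_partition[OF assms(1), of i]
  by (intro F_measurable_M[of "p i"]) (auto simp: simple_process_def)

lemma simple_value_jointly_measurable:
  assumes "simple_process M F t n p \<xi>"
  shows "jointly_measurable t (simple_value n p \<xi>)"
proof -
  have "(\<lambda>x. \<Sum>i<n. indicator {p i..<p (Suc i)} (fst x) * \<xi> i (snd x))
      \<in> borel_measurable (restrict_space borel {0..t} \<Otimes>\<^sub>M M)"
  proof (intro borel_measurable_sum borel_measurable_times)
    fix i assume i: "i \<in> {..<n}"
    have "(indicator {p i..<p (Suc i)} :: real \<Rightarrow> complex) \<in> borel_measurable (restrict_space borel {0..t})"
      by (intro measurable_restrict_space1) simp
    from measurable_compose[OF measurable_fst this]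
    show "(\<lambda>x. indicator {p i..<p (Suc i)} (fst x) :: complex)
      \<in> borel_measurable (restrict_space borel {0..t} \<Otimes>\<^sub>M M)" .
    show "(\<lambda>x. \<xi> i (snd x)) \<in> borel_measurable (restrict_space borel {0..t} \<Otimes>\<^sub>M M)"
      using i by (intro measurable_compose[OF measurable_snd simple_process_measurable[OF assms]]) auto
  qed
  then show ?thesis
    unfolding jointly_measurable_def simple_value_def by (simp add: case_prod_beta)
qed

lemma simple_integral_measurable:
  assumes "simple_process M F t n p \<xi>"
  shows "simple_integral n p \<xi> W \<in> borel_measurable M"
proof -
  have "(\<lambda>\<omega>. \<Sum>i<n. \<xi> i \<omega> * inc (p i) (p (Suc i)) \<omega>) \<in> borel_measurable M"
    using assms simple_process_partition[OF assms] simple_process_measurable[OF assms]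
    by (intro borel_measurable_sum borel_measurable_times inc_measurable)
       (auto simp: simple_process_def)
  then show ?thesis by (simp add: simple_integral_def[abs_def])
qed

lemma simple_integral_isometry:
  assumes p: "simple_process M F t n p \<xi>" and q: "simple_process M F t m q \<eta>"
  shows "(\<integral>\<^sup>+\<omega>. ennreal ((norm (simple_integral n p \<xi> W \<omega> - simple_integral m q \<eta> W \<omega>))\<^sup>2) \<partial>M)
    = sq_dist t (simple_value n p \<xi>) (simple_value m q \<eta>)"
proof -
  define K where "K = {..<n} <+> {..<m}"
  define a where "a = case_sum p q"
  define a' where "a' = case_sum (\<lambda>i. p (Suc i)) (\<lambda>i. q (Suc i))"
  define \<zeta> where "\<zeta> = case_sum \<xi> (\<lambda>i \<omega>. - \<eta> i \<omega>)"
  obtain C D where C: "\<And>i \<omega>. i < n \<Longrightarrow> \<omega> \<in> space M \<Longrightarrow> norm (\<xi> i \<omega>) \<le> C"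
    and D: "\<And>i \<omega>. i < m \<Longrightarrow> \<omega> \<in> space M \<Longrightarrow> norm (\<eta> i \<omega>) \<le> D"
    using p q unfolding simple_process_def by meson
  have S: "(\<Sum>k\<in>K. \<zeta> k \<omega> * inc (a k) (a' k) \<omega>) = simple_integral n p \<xi> W \<omega> - simple_integral m q \<eta> W \<omega>" for \<omega>
    unfolding K_def by (simp add: sum.Plus \<zeta>_def a_def a'_def simple_integral_def sum_negf)
  have v: "(\<Sum>k\<in>K. indicator {a k..<a' k} s * \<zeta> k \<omega>) = simple_value n p \<xi> s \<omega> - simple_value m q \<eta> s \<omega>" for s \<omega>
    unfolding K_def by (simp add: sum.Plus \<zeta>_def a_def a'_def simple_value_def sum_negf
        del: sum_mult_indicator sum_indicator_mult)
  have "(\<integral>\<^sup>+\<omega>. ennreal ((norm (\<Sum>k\<in>K. \<zeta> k \<omega> * inc (a k) (a' k) \<omega>))\<^sup>2) \<partial>M) =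
    (\<integral>\<^sup>+\<omega>. (\<integral>\<^sup>+s. ennreal ((norm (\<Sum>k\<in>K. indicator {a k..<a' k} s * \<zeta> k \<omega>))\<^sup>2) \<partial>lborel) \<partial>M)"
  proof (rule isometry[where C="max C D"])
    show "finite K" by (simp add: K_def)
    show "0 \<le> a k" "a k \<le> a' k" if "k \<in> K" for k
      using that p q simple_process_partition[OF p] simple_process_partition[OF q]
      by (auto simp: K_def a_def a'_def simple_process_def)
    show "\<zeta> k \<in> borel_measurable (F (a k))" if "k \<in> K" for k
      using that p q by (auto simp: K_def a_def \<zeta>_def simple_process_def)
    show "norm (\<zeta> k \<omega>) \<le> max C D" if "k \<in> K" "\<omega> \<in> space M" for k \<omega>
      using that C D by (fastforce simp: K_def \<zeta>_def le_max_iff_disj)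
  qed
  also have "\<dots> = sq_dist t (simple_value n p \<xi>) (simple_value m q \<eta>)"
    unfolding S v sq_dist_def
  proof (intro nn_integral_cong)
    fix \<omega> s
    have "simple_value n p \<xi> s \<omega> = 0" if "s \<notin> {0..t}"
      unfolding simple_value_def
    proof (rule sum.neutral, rule ballI)
      fix i assume "i \<in> {..<n}"
      then have "s \<notin> {p i..<p (Suc i)}"
        using that simple_process_partition[OF p, of i] simple_process_partition[OF p, of "Suc i"] by auto
      then show "indicator {p i..<p (Suc i)} s * \<xi> i \<omega> = 0" by simp
    qed
    moreover have "simple_value m q \<eta> s \<omega> = 0" if "s \<notin> {0..t}"
      unfolding simple_value_def
    proof (rule sum.neutral, rule ballI)
      fix i assume "i \<in> {..<m}"
      then have "s \<notin> {q i..<q (Suc i)}"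
        using that simple_process_partition[OF q, of i] simple_process_partition[OF q, of "Suc i"] by auto
      then show "indicator {q i..<q (Suc i)} s * \<eta> i \<omega> = 0" by simp
    qed
    ultimately show "ennreal ((norm (simple_value n p \<xi> s \<omega> - simple_value m q \<eta> s \<omega>))\<^sup>2) =
      ennreal ((norm (simple_value n p \<xi> s \<omega> - simple_value m q \<eta> s \<omega>))\<^sup>2) * indicator {0..t} s"
      by (auto split: split_indicator)
  qed
  finally show ?thesis unfolding S .
qed

text \<open>An Ito integral is defined by some approximating sequence of simple processes. By the isometry
  any other simple process that is close to the integrand has an integral close to the same limit:
  pass to the limit in the comparison with the given sequence.\<close>

lemma ito_integral_simple_error:
  assumes H: "has_ito_integral M F W t H J" and p: "simple_process M F t n p \<xi>"
  shows "(\<integral>\<^sup>+\<omega>. ennreal ((norm (simple_integral n p \<xi> W \<omega> - J \<omega>))\<^sup>2) \<partial>M)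
    \<le> 4 * sq_dist t (simple_value n p \<xi>) H"
proof -
  let ?S = "simple_integral n p \<xi> W" and ?v = "simple_value n p \<xi>"
  from H obtain m q \<eta> where q: "\<And>k::nat. simple_process M F t (m k) (q k) (\<eta> k)"
    and v: "(\<lambda>k. sq_dist t (simple_value (m k) (q k) (\<eta> k)) H) \<longlonglongrightarrow> 0"
    and s: "(\<lambda>k. \<integral>\<^sup>+\<omega>. ennreal ((norm (simple_integral (m k) (q k) (\<eta> k) W \<omega> - J \<omega>))\<^sup>2) \<partial>M) \<longlonglongrightarrow> 0"
    unfolding has_ito_integral_def sq_dist_def by blast
  have J[measurable]: "J \<in> borel_measurable M" and Hj: "jointly_measurable t H"
    using H by (auto simp: has_ito_integral_def ito_integrand_def jointly_measurable_def)
  let ?Sk = "\<lambda>k. simple_integral (m k) (q k) (\<eta> k) W" and ?vk = "\<lambda>k. simple_value (m k) (q k) (\<eta> k)"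
  let ?e = "\<lambda>k. \<integral>\<^sup>+\<omega>. ennreal ((norm (?Sk k \<omega> - J \<omega>))\<^sup>2) \<partial>M"
  note [measurable] = simple_integral_measurable[OF p] simple_integral_measurable[OF q]
  have *: "(\<integral>\<^sup>+\<omega>. ennreal ((norm (?S \<omega> - J \<omega>))\<^sup>2) \<partial>M)
      \<le> 2 * (2 * sq_dist t ?v H + 2 * sq_dist t (?vk k) H) + 2 * ?e k" for k
  proof -
    have "(\<integral>\<^sup>+\<omega>. ennreal ((norm (?S \<omega> - J \<omega>))\<^sup>2) \<partial>M) \<le>
      (\<integral>\<^sup>+\<omega>. 2 * ennreal ((norm (?S \<omega> - ?Sk k \<omega>))\<^sup>2) + 2 * ennreal ((norm (?Sk k \<omega> - J \<omega>))\<^sup>2) \<partial>M)"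
      by (intro nn_integral_mono norm_diff_square_le)
    also have "\<dots> = 2 * sq_dist t ?v (?vk k) + 2 * ?e k"
      unfolding simple_integral_isometry[OF p q, symmetric]
      by (subst nn_integral_add) (auto simp: nn_integral_cmult)
    also have "\<dots> \<le> 2 * (2 * sq_dist t ?v H + 2 * sq_dist t (?vk k) H) + 2 * ?e k"
      using sq_dist_triangle[OF simple_value_jointly_measurable[OF p] Hj
          simple_value_jointly_measurable[OF q], of k]
      by (intro add_right_mono mult_left_mono) (auto simp: sq_dist_commute)
    finally show ?thesis .
  qed
  have "(\<lambda>k. 2 * (2 * sq_dist t ?v H + 2 * sq_dist t (?vk k) H) + 2 * ?e k)
      \<longlonglongrightarrow> 2 * (2 * sq_dist t ?v H + 2 * 0) + 2 * 0"
    by (intro tendsto_add ennreal_tendsto_cmult tendsto_const v s) auto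
  then have "(\<integral>\<^sup>+\<omega>. ennreal ((norm (?S \<omega> - J \<omega>))\<^sup>2) \<partial>M) \<le> 2 * (2 * sq_dist t ?v H + 2 * 0) + 2 * 0"
    using * by (intro LIMSEQ_le_const) auto
  then show ?thesis by (simp add: mult.assoc[symmetric])
qed

end

section \<open>Left-endpoint sums\<close>

definition grid :: "real \<Rightarrow> nat \<Rightarrow> nat \<Rightarrow> real" where
  "grid T N i = T * real i / real N"

lemma grid_simps [simp]: "grid T N 0 = 0" "0 < N \<Longrightarrow> grid T N N = T"
  by (auto simp: grid_def)

lemma grid_mono: "0 \<le> T \<Longrightarrow> i \<le> j \<Longrightarrow> grid T N i \<le> grid T N j"
  by (auto simp: grid_def intro!: divide_right_mono mult_left_mono)

lemma grid_step: "grid T N (Suc i) - grid T N i = T / real N"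
  by (simp add: grid_def distrib_left add_divide_distrib)

lemma grid_nonneg: "0 \<le> T \<Longrightarrow> 0 \<le> grid T N i"
  by (auto simp: grid_def)

lemma simple_value_eq:
  assumes mono: "\<And>i j. i \<le> j \<Longrightarrow> p i \<le> p j" and "i < n" "p i \<le> s" "s < p (Suc i)"
  shows "simple_value n p \<xi> s \<omega> = \<xi> i \<omega>"
proof -
  have "indicator {p j..<p (Suc j)} s * \<xi> j \<omega> = (if j = i then \<xi> i \<omega> else 0)" for j
  proof (cases "j = i")
    case False
    then consider "Suc j \<le> i" | "Suc i \<le> j" by linarith
    then have "s \<notin> {p j..<p (Suc j)}"
      using mono[of "Suc j" i] mono[of "Suc i" j] assms(3,4) by cases auto
    then show ?thesis using False by simp
  qed (use assms in auto)
  then show ?thesis using assms(2) by (simp add: simple_value_def)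
qed

lemma grid_cell:
  assumes "0 < T" "0 < N" "0 \<le> s" "s < T"
  obtains i where "i < N" "grid T N i \<le> s" "s < grid T N (Suc i)"
proof
  let ?i = "nat \<lfloor>s * N / T\<rfloor>"
  have r: "real ?i = of_int \<lfloor>s * N / T\<rfloor>" using assms by simp
  then have i: "real ?i \<le> s * N / T" "s * N / T < real ?i + 1" by linarith+
  have "s * N / T < N" using assms by (simp add: field_simps)
  with i(1) show "?i < N" by linarith
  show "grid T N ?i \<le> s" "s < grid T N (Suc ?i)"
    using i assms(1,2) unfolding grid_def by (simp_all add: pos_le_divide_eq pos_divide_le_eq pos_less_divide_eq pos_divide_less_eq mult.commute add.commute)
qed

lemma simple_value_grid_tendsto:
  fixes H :: "real \<Rightarrow> 'w \<Rightarrow> complex"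
  assumes "0 < T" "continuous_on {0..T} (\<lambda>s. H s \<omega>)" "0 \<le> s" "s < T"
  shows "(\<lambda>N. simple_value N (grid T N) (\<lambda>i. H (grid T N i)) s \<omega>) \<longlonglongrightarrow> H s \<omega>"
proof -
  have "\<exists>u. 0 \<le> u \<and> u \<le> T \<and> \<bar>u - s\<bar> \<le> T / N \<and>
      simple_value N (grid T N) (\<lambda>i. H (grid T N i)) s \<omega> = H u \<omega>" if N: "0 < N" for N
  proof -
    obtain i where i: "i < N" "grid T N i \<le> s" "s < grid T N (Suc i)"
      using grid_cell[OF assms(1) N assms(3,4)] by blast
    then show ?thesis
      using simple_value_eq[of "grid T N", OF grid_mono i] grid_step[of T N i] assms
        grid_nonneg[of T N i]
      by (intro exI[of _ "grid T N i"]) auto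
  qed
  then obtain u where u: "\<And>N. 0 < N \<Longrightarrow> 0 \<le> u N \<and> u N \<le> T \<and> \<bar>u N - s\<bar> \<le> T / real N \<and>
      simple_value N (grid T N) (\<lambda>i. H (grid T N i)) s \<omega> = H (u N) \<omega>"
    by metis
  have "(\<lambda>N. T / real N) \<longlonglongrightarrow> 0" by (rule lim_const_over_n)
  then have "(\<lambda>N. u N - s) \<longlonglongrightarrow> 0"
    by (rule Lim_null_comparison[rotated]) (use u in \<open>auto simp: eventually_at_top_dense\<close>)
  then have "u \<longlonglongrightarrow> s" by (simp add: LIM_zero_iff)
  then have "(\<lambda>N. H (u N) \<omega>) \<longlonglongrightarrow> H s \<omega>"
    using u assms by (intro continuous_on_tendsto_compose[OF assms(2)])
      (auto simp: eventually_at_top_dense)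
  then show ?thesis
    by (rule Lim_transform_eventually) (use u in \<open>auto simp: eventually_at_top_dense\<close>)
qed

context isotropic_noise
begin

text \<open>A simple process has to be bounded and to take on each cell a value known at the left endpoint;
  the left-endpoint discretisation of a bounded adapted process has both properties.\<close>

lemma grid_simple_process:
  assumes "0 \<le> T" "0 < N" "k \<le> N"
    and "\<And>t. 0 \<le> t \<Longrightarrow> t \<le> T \<Longrightarrow> H t \<in> borel_measurable (F t)"
    and "\<And>t \<omega>. 0 \<le> t \<Longrightarrow> t \<le> T \<Longrightarrow> norm (H t \<omega>) \<le> C"
  shows "simple_process M F (grid T N k) k (grid T N) (\<lambda>i. H (grid T N i))"
proof -
  have "0 \<le> grid T N i" "grid T N i \<le> T" if "i < k" for i
    using grid_nonneg[of T N i] grid_mono[of T i N N] assms(1-3) that by auto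
  then show ?thesis
    using assms unfolding simple_process_def by (auto intro!: grid_mono exI[of _ C])
qed

text \<open>One error controls the discretisations on all the intervals \<open>[0, grid T N k]\<close> at once. The two
  step functions can differ at the point \<open>grid T N k\<close>, hence the almost everywhere comparison.\<close>

lemma sq_dist_grid_prefix:
  assumes "0 \<le> T" "0 < N" "k \<le> N"
  shows "sq_dist (grid T N k) (simple_value k (grid T N) \<xi>) H \<le> sq_dist T (simple_value N (grid T N) \<xi>) H"
  unfolding sq_dist_def
proof (rule nn_integral_mono, rule nn_integral_mono_AE)
  fix \<omega>
  have le: "grid T N k \<le> T" using grid_mono[of T k N N] assms by auto
  have eq: "simple_value k (grid T N) \<xi> s \<omega> = simple_value N (grid T N) \<xi> s \<omega>" if "s < grid T N k" for s
    unfolding simple_value_def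
  proof (rule sum.mono_neutral_left)
    have "s \<notin> {grid T N i..<grid T N (Suc i)}" if "k \<le> i" for i
      using grid_mono[OF assms(1) that, of N] \<open>s < grid T N k\<close> by auto
    then show "\<forall>i\<in>{..<N} - {..<k}. indicator {grid T N i..<grid T N (Suc i)} s * \<xi> i \<omega> = 0"
      by simp
  qed (use assms in auto)
  show "AE s in lborel. ennreal ((norm (simple_value k (grid T N) \<xi> s \<omega> - H s \<omega>))\<^sup>2) * indicator {0..grid T N k} s
     \<le> ennreal ((norm (simple_value N (grid T N) \<xi> s \<omega> - H s \<omega>))\<^sup>2) * indicator {0..T} s"
    using AE_lborel_singleton[of "grid T N k"]
  proof eventually_elim
    case (elim s)
    then show ?case using le eq[of s] by (auto split: split_indicator)
  qed
qed

text \<open>Continuous paths give pointwise convergence of the step functions before \<open>T\<close>, and the bound 1 on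
  the integrand allows dominated convergence, first in time and then over the sample space.\<close>

lemma sq_dist_grid_tendsto:
  assumes T: "0 < T" and H: "jointly_measurable T H"
    and ad: "\<And>t. 0 \<le> t \<Longrightarrow> t \<le> T \<Longrightarrow> H t \<in> borel_measurable (F t)"
    and bd: "\<And>t \<omega>. 0 \<le> t \<Longrightarrow> t \<le> T \<Longrightarrow> norm (H t \<omega>) \<le> 1"
    and cont: "AE \<omega> in M. continuous_on {0..T} (\<lambda>t. H t \<omega>)"
  shows "(\<lambda>N. sq_dist T (simple_value N (grid T N) (\<lambda>i. H (grid T N i))) H) \<longlonglongrightarrow> 0"
proof -
  let ?R = "restrict_space lborel {0..T}"
  define v where "v N = simple_value N (grid T N) (\<lambda>i. H (grid T N i))" for N
  define I where "I N \<omega> = (\<integral>\<^sup>+s. ennreal ((norm (v N s \<omega> - H s \<omega>))\<^sup>2) \<partial>?R)" for N \<omega>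
  have v: "jointly_measurable T (v N)" for N
  proof (cases "N = 0")
    case True
    then show ?thesis by (simp add: v_def simple_value_def[abs_def] jointly_measurable_def)
  next
    case False
    then show ?thesis
      using grid_simple_process[where T=T and N=N and k=N and H=H and C=1] T ad bd
        simple_value_jointly_measurable[of T N "grid T N"] by (auto simp: v_def)
  qed
  have vb: "norm (v N s \<omega>) \<le> 1" if s: "0 \<le> s" "s < T" for N s \<omega>
  proof (cases "N = 0")
    case False
    then obtain i where i: "i < N" "grid T N i \<le> s" "s < grid T N (Suc i)"
      using grid_cell[OF T _ s] by blast
    have "v N s \<omega> = H (grid T N i) \<omega>"
      unfolding v_def using T i by (intro simple_value_eq grid_mono) auto
    then show ?thesis using i s T grid_nonneg[of T N i] by (auto intro!: bd)
  qed (simp add: v_def simple_value_def)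
  have sing: "AE s in ?R. 0 \<le> s \<and> s < T"
    using AE_lborel_singleton[of T]
    by (subst AE_restrict_space_iff) (auto elim!: eventually_mono)
  have four: "ennreal ((norm (v N s \<omega> - H s \<omega>))\<^sup>2) \<le> 4" if "0 \<le> s" "s < T" for N s \<omega>
  proof -
    have "norm (v N s \<omega> - H s \<omega>) \<le> 2"
      using norm_triangle_ineq4[of "v N s \<omega>" "H s \<omega>"] vb[OF that, of N \<omega>] bd[of s \<omega>] that by simp
    then have "(norm (v N s \<omega> - H s \<omega>))\<^sup>2 \<le> 2\<^sup>2" by (intro power_mono) auto
    then have "ennreal ((norm (v N s \<omega> - H s \<omega>))\<^sup>2) \<le> ennreal 4" by (intro ennreal_leI) simp
    then show ?thesis by simp
  qed
  have R4: "(\<integral>\<^sup>+s. 4 \<partial>?R) < \<infinity>"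
    by (simp add: emeasure_restrict_space ennreal_mult_less_top emeasure_lborel_Icc_eq)
  have I4: "I N \<omega> \<le> (\<integral>\<^sup>+s. 4 \<partial>?R)" for N \<omega>
    unfolding I_def by (rule nn_integral_mono_AE) (rule AE_mp[OF sing], use four in auto)
  have "(\<lambda>N. \<integral>\<^sup>+\<omega>. I N \<omega> \<partial>M) \<longlonglongrightarrow> (\<integral>\<^sup>+\<omega>. 0 \<partial>M)"
  proof (rule nn_integral_dominated_convergence[where w="\<lambda>_. \<integral>\<^sup>+s. 4 \<partial>?R"])
    show "I N \<in> borel_measurable M" for N
      unfolding I_def[abs_def] by (rule sq_dist_inner_measurable[OF v H])
    show "(\<integral>\<^sup>+\<omega>. (\<integral>\<^sup>+s. 4 \<partial>?R) \<partial>M) < \<infinity>"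
      using R4 by (simp add: emeasure_space_1)
    show "AE \<omega> in M. (\<lambda>N. I N \<omega>) \<longlonglongrightarrow> 0"
      using cont AE_space
    proof eventually_elim
      case (elim \<omega>)
      have "(\<lambda>N. I N \<omega>) \<longlonglongrightarrow> (\<integral>\<^sup>+s. 0 \<partial>?R)"
        unfolding I_def
      proof (rule nn_integral_dominated_convergence[where w="\<lambda>_. 4"])
        show "(\<lambda>s. ennreal ((norm (v N s \<omega> - H s \<omega>))\<^sup>2)) \<in> borel_measurable ?R" for N
          using jointly_measurable_section[OF v elim(2), of N] jointly_measurable_section[OF H elim(2)]
          by measurable
        show "AE s in ?R. (\<lambda>N. ennreal ((norm (v N s \<omega> - H s \<omega>))\<^sup>2)) \<longlonglongrightarrow> 0"
          using sing
        proof eventually_elim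
          case e: (elim s)
          have "(\<lambda>N. v N s \<omega>) \<longlonglongrightarrow> H s \<omega>"
            unfolding v_def using simple_value_grid_tendsto[where H=H, OF T elim(1)] e by blast
          then have "(\<lambda>N. (norm (v N s \<omega> - H s \<omega>))\<^sup>2) \<longlonglongrightarrow> (norm (H s \<omega> - H s \<omega>))\<^sup>2"
            by (intro tendsto_intros)
          then show ?case using tendsto_ennrealI by fastforce
        qed
        show "AE s in ?R. ennreal ((norm (v N s \<omega> - H s \<omega>))\<^sup>2) \<le> 4" for N
          by (rule AE_mp[OF sing]) (use four in auto)
      qed (use R4 in auto)
      then show ?case by simp
    qed
  qed (use I4 in auto)
  then show ?thesis unfolding sq_dist_restrict I_def v_def by simp
qed

end

section \<open>One step of the discrete Dynkin inequality\<close>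

lemma sin_half_square_lipschitz: "\<bar>(sin (x / 2))\<^sup>2 - (sin (y / 2))\<^sup>2\<bar> \<le> \<bar>x - y\<bar>" for x y :: real
proof -
  have "(sin (x / 2))\<^sup>2 - (sin (y / 2))\<^sup>2 = (cos y - cos x) / 2"
    using cos_double_sin[of "x / 2"] cos_double_sin[of "y / 2"] by simp
  moreover have "\<bar>cos y - cos x\<bar> \<le> \<bar>y - x\<bar>"
    using mult_mono[OF abs_sin_le_one[of "(x + y) / 2"] abs_sin_x_le_abs_x[of "(x - y) / 2"]]
    by (simp add: cos_diff_cos abs_mult add.commute abs_minus_commute)
  ultimately show ?thesis by simp
qed

lemma abs_cube_add_le: "\<bar>a + b\<bar> ^ 3 \<le> 4 * \<bar>a\<bar> ^ 3 + 4 * \<bar>b\<bar> ^ 3" for a b :: real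
proof -
  have "\<bar>a + b\<bar> ^ 3 \<le> (\<bar>a\<bar> + \<bar>b\<bar>) ^ 3" by (intro power_mono) auto
  also have "4 * \<bar>a\<bar> ^ 3 + 4 * \<bar>b\<bar> ^ 3 - (\<bar>a\<bar> + \<bar>b\<bar>) ^ 3 = 3 * (\<bar>a\<bar> + \<bar>b\<bar>) * (\<bar>a\<bar> - \<bar>b\<bar>)\<^sup>2"
    by (simp add: power2_eq_square power3_eq_cube algebra_simps)
  then have "(\<bar>a\<bar> + \<bar>b\<bar>) ^ 3 \<le> 4 * \<bar>a\<bar> ^ 3 + 4 * \<bar>b\<bar> ^ 3"
    by (smt (verit) mult_nonneg_nonneg zero_le_power2 abs_ge_zero)
  finally show ?thesis .
qed

text \<open>Weighted arithmetic-geometric mean: with \<open>h\<close> the time step, the weight \<open>sqrt h\<close> balances the second moment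
  (of order \<open>h\<close>) and the fourth moment (of order \<open>h\<^sup>2\<close>), and the third absolute moment becomes of
  order \<open>h * sqrt h\<close>.\<close>

lemma cube_le_square_fourth:
  fixes w h :: real assumes "0 < h" "0 \<le> w"
  shows "w ^ 3 \<le> (sqrt h * w\<^sup>2 + w ^ 4 / sqrt h) / 2"
proof -
  have "0 \<le> w\<^sup>2 * (w - sqrt h)\<^sup>2" by simp
  then have "2 * w ^ 3 * sqrt h \<le> w ^ 4 + h * w\<^sup>2"
    using assms by (simp add: power2_eq_square power3_eq_cube power4_eq_xxxx algebra_simps)
  then have "2 * w ^ 3 \<le> (w ^ 4 + h * w\<^sup>2) / sqrt h" using assms by (simp add: field_simps)
  also have "\<dots> = sqrt h * w\<^sup>2 + w ^ 4 / sqrt h"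
    using assms by (simp add: field_simps)
  finally show ?thesis by simp
qed

text \<open>A supersolution of rate \<open>c\<close>, with enough regularity for a Taylor expansion. In \<open>generator\<close> the
  diffusion coefficient \<open>z\<close> ranges over the whole interval \<open>[0, x\<^sup>2 / 4]\<close>, which contains
  \<open>(sin (x / 2))\<^sup>2\<close>, so that the test function need not know the trigonometric coefficient.
  The single constant \<open>K\<close> serves all error terms.\<close>

locale test_function =
  fixes g g1 g2 :: "real \<Rightarrow> real" and K \<delta> c :: real
  assumes measurable_test [measurable]: "g \<in> borel_measurable borel" "g1 \<in> borel_measurable borel"
      "g2 \<in> borel_measurable borel"
    and bounded_test: "\<bar>g x\<bar> \<le> K" "\<bar>g1 x\<bar> \<le> K" "\<bar>g2 x\<bar> \<le> K"
    and taylor: "g (x + r) \<le> g x + g1 x * r + g2 x / 2 * r\<^sup>2 + K * \<bar>r\<bar> ^ 3"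
    and lipschitz: "\<bar>g x - g y\<bar> \<le> K * \<bar>x - y\<bar>"
    and generator: "0 \<le> z \<Longrightarrow> z \<le> x\<^sup>2 / 4 \<Longrightarrow> \<delta> * g1 x + z * g2 x \<le> c * g x"
    and drift_nonneg: "0 \<le> \<delta>" and test_nonneg: "0 \<le> g x" and rate_nonneg: "0 \<le> c"
begin

lemma K_nonneg: "0 \<le> K" using bounded_test(1)[of 0] by linarith

text \<open>The diffusion coefficient is evaluated at the true phase difference \<open>x\<close> and the test function at its
  approximation \<open>y\<close>; the mismatch costs a term linear in the distance.\<close>

lemma generator_sin:
  "\<delta> * g1 y + (sin (x / 2))\<^sup>2 * g2 y \<le> c * g y + K * \<bar>x - y\<bar>"
proof -
  have "\<bar>sin (y / 2)\<bar> \<le> \<bar>y / 2\<bar>" by (rule abs_sin_x_le_abs_x)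
  then have "(sin (y / 2))\<^sup>2 \<le> (y / 2)\<^sup>2" by (simp only: abs_le_square_iff)
  then have "\<delta> * g1 y + (sin (y / 2))\<^sup>2 * g2 y \<le> c * g y"
    by (intro generator) (auto simp: power_divide)
  moreover have "((sin (x / 2))\<^sup>2 - (sin (y / 2))\<^sup>2) * g2 y \<le> \<bar>x - y\<bar> * K"
    using mult_mono[OF sin_half_square_lipschitz[of x y] bounded_test(3)[of y]]
    by (simp flip: abs_mult)
  ultimately show ?thesis by (simp add: algebra_simps)
qed

text \<open>The right-hand side is arranged as a sum of products of a function of the past and a power
  of the increment \<open>w\<close>, ready for \<open>past_times_increment\<close>. The square of \<open>Re (d * w)\<close> enters through
  \<open>(Re z)\<^sup>2 = (\<bar>z\<bar>\<^sup>2 + Re (z\<^sup>2)) / 2\<close>, whose second part has mean 0 by isotropy.\<close>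

lemma one_step_pointwise:
  fixes d w :: complex
  assumes h: "0 < h" and d: "(norm d)\<^sup>2 = 4 * (sin (x / 2))\<^sup>2"
  shows "g (y + (\<delta> * h + Re (d * w))) \<le> g y + \<delta> * h * g1 y + K * (\<delta> * h)\<^sup>2 / 2
      + Re (of_real (g1 y + \<delta> * h * g2 y) * d * w)
      + Re (of_real (g2 y * (norm d)\<^sup>2 / 4) * (w * cnj w)) + Re (of_real (g2 y / 4) * d\<^sup>2 * w\<^sup>2)
      + K * (4 * (\<delta> * h) ^ 3 + 16 * (sqrt h * (norm w)\<^sup>2 + norm w ^ 4 / sqrt h))"
proof -
  let ?r = "\<delta> * h + Re (d * w)"
  have Re_real: "Re (of_real r * z) = r * Re z" for r z by simp
  have sq: "(Re z)\<^sup>2 = ((norm z)\<^sup>2 + Re (z\<^sup>2)) / 2" for z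
    unfolding cmod_power2 by (simp add: power2_eq_square)
  have "(norm d)\<^sup>2 \<le> 2\<^sup>2"
    unfolding d using abs_sin_le_one[of "x / 2"] by (simp add: abs_square_le_1)
  then have d2: "norm d \<le> 2" by (rule power2_le_imp_le) simp
  have "\<bar>Re (d * w)\<bar> \<le> 2 * norm w"
    using abs_Re_le_cmod[of "d * w"] d2 mult_right_mono[OF d2, of "norm w"] by (simp add: norm_mult)
  then have "\<bar>Re (d * w)\<bar> ^ 3 \<le> (2 * norm w) ^ 3" by (intro power_mono) auto
  also have "\<dots> \<le> 4 * (sqrt h * (norm w)\<^sup>2 + norm w ^ 4 / sqrt h)"
    using cube_le_square_fourth[OF h, of "norm w"] by (simp add: power_mult_distrib)
  finally have "\<bar>?r\<bar> ^ 3 \<le> 4 * (\<delta> * h) ^ 3 + 16 * (sqrt h * (norm w)\<^sup>2 + norm w ^ 4 / sqrt h)"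
    using abs_cube_add_le[of "\<delta> * h" "Re (d * w)"] drift_nonneg h by simp
  from mult_left_mono[OF this K_nonneg]
  have 1: "g (y + ?r) \<le> g y + g1 y * ?r + g2 y / 2 * ?r\<^sup>2
      + K * (4 * (\<delta> * h) ^ 3 + 16 * (sqrt h * (norm w)\<^sup>2 + norm w ^ 4 / sqrt h))"
    using taylor[of y ?r] by linarith
  have "g2 y * (\<delta> * h)\<^sup>2 \<le> K * (\<delta> * h)\<^sup>2" using bounded_test(3)[of y] by (intro mult_right_mono) auto
  then have 2: "g2 y / 2 * ?r\<^sup>2 \<le> K * (\<delta> * h)\<^sup>2 / 2 + \<delta> * h * g2 y * Re (d * w) + g2 y / 2 * (Re (d * w))\<^sup>2"
    unfolding power2_sum[of "\<delta> * h"] by (simp add: algebra_simps del: times_complex.sel)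
  have 3: "g2 y / 2 * (Re (d * w))\<^sup>2 =
      Re (of_real (g2 y * (norm d)\<^sup>2 / 4) * (w * cnj w)) + Re (of_real (g2 y / 4) * d\<^sup>2 * w\<^sup>2)"
  proof -
    define R where "R = Re ((d * w)\<^sup>2)"
    have "Re (of_real (g2 y / 4) * d\<^sup>2 * w\<^sup>2) = g2 y / 4 * R"
      unfolding R_def by (simp only: power_mult_distrib mult.assoc Re_real)
    moreover have "Re (of_real (g2 y * (norm d)\<^sup>2 / 4) * (w * cnj w)) = g2 y * (norm d)\<^sup>2 / 4 * (norm w)\<^sup>2"
      by (simp only: complex_norm_square[symmetric] Re_real Re_complex_of_real)
    moreover have "(norm (d * w))\<^sup>2 = (norm d)\<^sup>2 * (norm w)\<^sup>2"
      by (simp add: norm_mult power_mult_distrib)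
    ultimately show ?thesis
      unfolding sq[of "d * w"] R_def[symmetric] by (simp add: field_simps)
  qed
  have 4: "Re (of_real (g1 y + \<delta> * h * g2 y) * d * w) = (g1 y + \<delta> * h * g2 y) * Re (d * w)"
    by (simp only: mult.assoc Re_real)
  show ?thesis using 1 2 unfolding 3 4 by (simp add: algebra_simps)
qed

end

context isotropic_noise
begin

text \<open>The terms linear in the increment and the pseudo-variance term vanish in the mean, and
  the variance term becomes \<open>h * E ((sin (X / 2))\<^sup>2 * g2 Y)\<close>. Together with the drift this
  is the generator, which the supersolution property bounds by \<open>c * g\<close>.\<close>

lemma expectation_one_step:
  assumes "test_function g g1 g2 K \<delta> c"
    and st: "0 \<le> s" "s < t" and h: "h = t - s"
    and Y: "Y \<in> borel_measurable (F s)" and D: "D \<in> borel_measurable (F s)"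
    and X: "X \<in> borel_measurable M" and XY: "integrable M (\<lambda>\<omega>. X \<omega> - Y \<omega>)"
    and DX: "\<And>\<omega>. \<omega> \<in> space M \<Longrightarrow> (norm (D \<omega>))\<^sup>2 = 4 * (sin (X \<omega> / 2))\<^sup>2"
  shows "expectation (\<lambda>\<omega>. g (Y \<omega> + (\<delta> * h + Re (D \<omega> * inc s t \<omega>)))) \<le>
    (1 + c * h) * expectation (\<lambda>\<omega>. g (Y \<omega>)) + K * h * expectation (\<lambda>\<omega>. \<bar>X \<omega> - Y \<omega>\<bar>)
      + K * (h\<^sup>2 * \<delta>\<^sup>2 + 4 * (\<delta> * h) ^ 3 + 64 * h * sqrt h)"
proof -
  interpret test_function g g1 g2 K \<delta> c by fact
  have h0: "0 < h" and st': "0 \<le> s" "s \<le> t" using st h by auto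
  note [measurable] = F_measurable_M[OF st(1) Y] F_measurable_M[OF st(1) D] X inc_measurable[OF st']
  have D2: "norm (D \<omega>) \<le> 2" if "\<omega> \<in> space M" for \<omega>
  proof -
    have "(norm (D \<omega>))\<^sup>2 \<le> 2\<^sup>2"
      unfolding DX[OF that] using abs_sin_le_one[of "X \<omega> / 2"] by (simp add: abs_square_le_1)
    then show ?thesis by (rule power2_le_imp_le) simp
  qed
  \<comment> \<open>the coefficients of the increment, of its squared modulus and of its square\<close>
  define A where "A \<omega> = complex_of_real (g1 (Y \<omega>) + \<delta> * h * g2 (Y \<omega>)) * D \<omega>" for \<omega>
  define P where "P \<omega> = complex_of_real (g2 (Y \<omega>) * (norm (D \<omega>))\<^sup>2 / 4)" for \<omega>
  define Q where "Q \<omega> = complex_of_real (g2 (Y \<omega>) / 4) * (D \<omega>)\<^sup>2" for \<omega>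
  have mF: "A \<in> borel_measurable (F s)" "P \<in> borel_measurable (F s)" "Q \<in> borel_measurable (F s)"
    unfolding A_def[abs_def] P_def[abs_def] Q_def[abs_def] using Y D by measurable
  note [measurable] = mF[THEN F_measurable_M[OF st(1)]]
  have bA: "norm (A \<omega>) \<le> (K + \<delta> * h * K) * 2" if "\<omega> \<in> space M" for \<omega>
  proof -
    have "\<bar>g1 (Y \<omega>) + \<delta> * h * g2 (Y \<omega>)\<bar> \<le> \<bar>g1 (Y \<omega>)\<bar> + \<delta> * h * \<bar>g2 (Y \<omega>)\<bar>"
      using abs_triangle_ineq[of "g1 (Y \<omega>)" "\<delta> * h * g2 (Y \<omega>)"] drift_nonneg h0 by (simp add: abs_mult)
    also have "\<dots> \<le> K + \<delta> * h * K"
      using bounded_test drift_nonneg h0 by (intro add_mono mult_left_mono) auto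
    finally show ?thesis
      unfolding A_def norm_mult norm_of_real using D2[OF that] drift_nonneg h0 K_nonneg
      by (intro mult_mono) auto
  qed
  have n2: "(norm (D \<omega>))\<^sup>2 \<le> 4" if "\<omega> \<in> space M" for \<omega>
    using power_mono[OF D2[OF that], of 2] by simp
  have bP: "norm (P \<omega>) \<le> K" if "\<omega> \<in> space M" for \<omega>
    using mult_mono[OF bounded_test(3)[of "Y \<omega>"] n2[OF that]] K_nonneg
    by (simp add: P_def norm_mult norm_divide norm_power)
  have bQ: "norm (Q \<omega>) \<le> K" if "\<omega> \<in> space M" for \<omega>
    using mult_mono[OF bounded_test(3)[of "Y \<omega>"] n2[OF that]] K_nonneg
    by (simp add: Q_def norm_mult norm_divide norm_power)
  have i: "integrable M A" "integrable M P" "integrable M Q"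
    using bA bP bQ by (auto intro!: integrable_const_bound)
  have iA: "has_bochner_integral M (\<lambda>\<omega>. Re (A \<omega> * inc s t \<omega>)) 0"
    using has_bochner_integral_bounded_linear[OF bounded_linear_Re
        past_times_increment[where f="\<lambda>x. x", OF st' mF(1) i(1) _ increment_mean[OF st']]] by simp
  have iP: "has_bochner_integral M (\<lambda>\<omega>. Re (P \<omega> * (inc s t \<omega> * cnj (inc s t \<omega>)))) (h * Re (expectation P))"
    using has_bochner_integral_bounded_linear[OF bounded_linear_Re
        past_times_increment[where f="\<lambda>x. x * cnj x", OF st' mF(2) i(2) _ increment_variance[OF st']]]
    by (simp add: h mult.commute)
  have iQ: "has_bochner_integral M (\<lambda>\<omega>. Re (Q \<omega> * (inc s t \<omega>)\<^sup>2)) 0"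
    using has_bochner_integral_bounded_linear[OF bounded_linear_Re
        past_times_increment[where f="\<lambda>x. x\<^sup>2", OF st' mF(3) i(3) _ increment_pseudo_variance[OF st']]]
    by simp
  have w2: "has_bochner_integral M (\<lambda>\<omega>. (norm (inc s t \<omega>))\<^sup>2) h"
    using has_bochner_integral_bounded_linear[OF bounded_linear_Re increment_variance[OF st']]
    unfolding complex_norm_square[symmetric] by (simp add: h del: of_real_power)
  have w4: "has_bochner_integral M (\<lambda>\<omega>. norm (inc s t \<omega>) ^ 4) (expectation (\<lambda>\<omega>. norm (inc s t \<omega>) ^ 4))"
    using increment_fourth_moment[OF st'] by (simp add: has_bochner_integral_iff)
  have ig: "integrable M (\<lambda>\<omega>. g (Y \<omega>))" "integrable M (\<lambda>\<omega>. g1 (Y \<omega>))"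
    using bounded_test by (auto intro!: integrable_const_bound[where B=K])
  define E4 where "E4 = expectation (\<lambda>\<omega>. norm (inc s t \<omega>) ^ 4)"
  define L where "L \<omega> = g (Y \<omega>) + \<delta> * h * g1 (Y \<omega>) + K * (\<delta> * h)\<^sup>2 / 2
      + Re (A \<omega> * inc s t \<omega>) + Re (P \<omega> * (inc s t \<omega> * cnj (inc s t \<omega>))) + Re (Q \<omega> * (inc s t \<omega>)\<^sup>2)
      + K * (4 * (\<delta> * h) ^ 3 + 16 * (sqrt h * (norm (inc s t \<omega>))\<^sup>2 + norm (inc s t \<omega>) ^ 4 / sqrt h))" for \<omega>
  have iL: "has_bochner_integral M L (expectation (\<lambda>\<omega>. g (Y \<omega>)) + \<delta> * h * expectation (\<lambda>\<omega>. g1 (Y \<omega>))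
      + K * (\<delta> * h)\<^sup>2 / 2 + 0 + h * Re (expectation P) + 0
      + K * (4 * (\<delta> * h) ^ 3 + 16 * (sqrt h * h + E4 / sqrt h)))"
    unfolding L_def[abs_def] E4_def
    by (intro has_bochner_integral_add has_bochner_integral_mult_right iA iP iQ w2 w4
        has_bochner_integral_divide has_bochner_integral_integrable ig)
       (simp_all add: has_bochner_integral_iff prob_space)
  have "expectation (\<lambda>\<omega>. g (Y \<omega> + (\<delta> * h + Re (D \<omega> * inc s t \<omega>)))) \<le> expectation L"
  proof (rule integral_mono)
    show "integrable M (\<lambda>\<omega>. g (Y \<omega> + (\<delta> * h + Re (D \<omega> * inc s t \<omega>))))"
    proof (rule integrable_const_bound[where B=K])
      show "(\<lambda>\<omega>. g (Y \<omega> + (\<delta> * h + Re (D \<omega> * inc s t \<omega>)))) \<in> borel_measurable M"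
        by measurable
    qed (use bounded_test in auto)
    show "integrable M L" using iL by (auto simp: has_bochner_integral_iff)
    show "g (Y \<omega> + (\<delta> * h + Re (D \<omega> * inc s t \<omega>))) \<le> L \<omega>" if "\<omega> \<in> space M" for \<omega>
      using one_step_pointwise[OF h0 DX[OF that], of "Y \<omega>" "inc s t \<omega>"]
      unfolding L_def A_def P_def Q_def .
  qed
  also have "expectation L = expectation (\<lambda>\<omega>. g (Y \<omega>))
      + h * (\<delta> * expectation (\<lambda>\<omega>. g1 (Y \<omega>)) + Re (expectation P))
      + K * ((\<delta> * h)\<^sup>2 / 2 + 4 * (\<delta> * h) ^ 3 + 16 * (sqrt h * h + E4 / sqrt h))"
    using iL by (simp add: has_bochner_integral_iff algebra_simps)
  also have "\<delta> * expectation (\<lambda>\<omega>. g1 (Y \<omega>)) + Re (expectation P) \<le>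
      c * expectation (\<lambda>\<omega>. g (Y \<omega>)) + K * expectation (\<lambda>\<omega>. \<bar>X \<omega> - Y \<omega>\<bar>)"
  proof -
    have rP: "integrable M (\<lambda>\<omega>. Re (P \<omega>))" "Re (expectation P) = expectation (\<lambda>\<omega>. Re (P \<omega>))"
      using has_bochner_integral_bounded_linear[OF bounded_linear_Re
          has_bochner_integral_integrable[OF i(2)]] by (auto simp: has_bochner_integral_iff)
    have "expectation (\<lambda>\<omega>. \<delta> * g1 (Y \<omega>) + Re (P \<omega>)) \<le>
        expectation (\<lambda>\<omega>. c * g (Y \<omega>) + K * \<bar>X \<omega> - Y \<omega>\<bar>)"
    proof (rule integral_mono)
      show "\<delta> * g1 (Y \<omega>) + Re (P \<omega>) \<le> c * g (Y \<omega>) + K * \<bar>X \<omega> - Y \<omega>\<bar>" if "\<omega> \<in> space M" for \<omega>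
        using generator_sin[of "Y \<omega>" "X \<omega>"] unfolding P_def Re_complex_of_real DX[OF that]
        by (simp add: mult.commute)
    qed (use ig rP XY in auto)
    then show ?thesis using ig rP XY by simp
  qed
  also have "E4 \<le> 3 * h\<^sup>2" using increment_fourth_moment[OF st'] by (simp add: E4_def h)
  finally have "expectation (\<lambda>\<omega>. g (Y \<omega> + (\<delta> * h + Re (D \<omega> * inc s t \<omega>)))) \<le> expectation (\<lambda>\<omega>. g (Y \<omega>))
      + h * (c * expectation (\<lambda>\<omega>. g (Y \<omega>)) + K * expectation (\<lambda>\<omega>. \<bar>X \<omega> - Y \<omega>\<bar>))
      + K * ((\<delta> * h)\<^sup>2 / 2 + 4 * (\<delta> * h) ^ 3 + 16 * (sqrt h * h + 3 * h\<^sup>2 / sqrt h))"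
    using h0 K_nonneg by (simp add: mult_left_mono divide_right_mono)
  also have "3 * h\<^sup>2 / sqrt h = 3 * (sqrt h * h)"
    using h0 by (simp add: field_simps power2_eq_square)
  finally have "expectation (\<lambda>\<omega>. g (Y \<omega> + (\<delta> * h + Re (D \<omega> * inc s t \<omega>)))) \<le>
    (1 + c * h) * expectation (\<lambda>\<omega>. g (Y \<omega>)) + K * h * expectation (\<lambda>\<omega>. \<bar>X \<omega> - Y \<omega>\<bar>)
      + K * ((\<delta> * h)\<^sup>2 / 2 + 4 * (\<delta> * h) ^ 3 + 64 * (sqrt h * h))"
    by (simp add: algebra_simps)
  moreover have "K * ((\<delta> * h)\<^sup>2 / 2 + 4 * (\<delta> * h) ^ 3 + 64 * (sqrt h * h)) \<le>
     K * (h\<^sup>2 * \<delta>\<^sup>2 + 4 * (\<delta> * h) ^ 3 + 64 * h * sqrt h)"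
    by (rule mult_left_mono[OF _ K_nonneg]) (simp add: power_mult_distrib mult_ac)
  ultimately show ?thesis by linarith
qed

end

section \<open>Dynkin inequality for the phase difference\<close>

lemma norm_phase_diff_square:
  "(norm (exp (- \<i> * complex_of_real b) - exp (- \<i> * complex_of_real a)))\<^sup>2 = 4 * (sin ((b - a) / 2))\<^sup>2"
proof -
  have e: "exp (- \<i> * complex_of_real x) = cis (- x)" for x by (simp add: cis_conv_exp)
  have "(norm (cis (- b) - cis (- a)))\<^sup>2 = (cos b - cos a)\<^sup>2 + (sin b - sin a)\<^sup>2"
    unfolding cmod_power2 by (simp add: power2_commute)
  also have "\<dots> = 2 - 2 * cos (b - a)"
    unfolding cos_diff power2_diff by (simp add: sin_squared_eq)
  also have "\<dots> = 4 * (sin ((b - a) / 2))\<^sup>2"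
    using cos_double_sin[of "(b - a) / 2"] unfolding nonzero_mult_div_cancel_left[OF zero_neq_numeral[symmetric]]
      times_divide_eq_right by simp
  finally show ?thesis unfolding e .
qed

lemma affine_recursion_le:
  fixes a :: "nat \<Rightarrow> real"
  assumes step: "\<And>k. k < N \<Longrightarrow> a (Suc k) \<le> (1 + r) * a k + b" and "0 \<le> r" "0 \<le> b"
    and "k \<le> N"
  shows "a k \<le> (1 + r) ^ k * (a 0 + real k * b)"
  using \<open>k \<le> N\<close>
proof (induction k)
  case (Suc k)
  have "a (Suc k) \<le> (1 + r) * a k + b" using step Suc.prems by simp
  also have "\<dots> \<le> (1 + r) * ((1 + r) ^ k * (a 0 + real k * b)) + (1 + r) ^ Suc k * b"
  proof (rule add_mono)
    show "(1 + r) * a k \<le> (1 + r) * ((1 + r) ^ k * (a 0 + real k * b))"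
      using Suc assms(2) by (intro mult_left_mono) auto
    have "1 \<le> (1 + r) ^ Suc k" using assms(2) by (intro one_le_power) simp
    from mult_right_mono[OF this assms(3)] show "b \<le> (1 + r) ^ Suc k * b" by simp
  qed
  also have "\<dots> = (1 + r) ^ Suc k * (a 0 + real (Suc k) * b)" by (simp add: algebra_simps)
  finally show ?case .
qed simp

text \<open>The squared bound is stated as a nonnegative integral because that is the form in which the isometry
  delivers it; integrability is part of the conclusion.\<close>

lemma (in prob_space) L1_le_L2:
  fixes Z :: "'a \<Rightarrow> real"
  assumes [measurable]: "Z \<in> borel_measurable M" and Z: "(\<integral>\<^sup>+\<omega>. ennreal ((Z \<omega>)\<^sup>2) \<partial>M) \<le> ennreal (\<eta>\<^sup>2)"
    and "0 \<le> \<eta>"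
  shows "integrable M Z" "expectation (\<lambda>\<omega>. \<bar>Z \<omega>\<bar>) \<le> \<eta>"
proof -
  have i2: "integrable M (\<lambda>\<omega>. (Z \<omega>)\<^sup>2)"
    using Z le_less_trans[OF Z, of \<infinity>] by (intro integrableI_nonneg) auto
  show i: "integrable M Z" by (rule square_integrable_imp_integrable[OF _ i2]) simp
  have "ennreal (expectation (\<lambda>\<omega>. (Z \<omega>)\<^sup>2)) \<le> ennreal (\<eta>\<^sup>2)"
    using Z nn_integral_eq_integral[OF i2] by simp
  then have "expectation (\<lambda>\<omega>. (Z \<omega>)\<^sup>2) \<le> \<eta>\<^sup>2" by (simp add: ennreal_le_iff)
  moreover have "0 \<le> expectation (\<lambda>\<omega>. \<bar>Z \<omega>\<bar>\<^sup>2) - (expectation (\<lambda>\<omega>. \<bar>Z \<omega>\<bar>))\<^sup>2"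
    using variance_eq[of "\<lambda>\<omega>. \<bar>Z \<omega>\<bar>"] variance_positive[of "\<lambda>\<omega>. \<bar>Z \<omega>\<bar>"] i i2 by simp
  ultimately have "(expectation (\<lambda>\<omega>. \<bar>Z \<omega>\<bar>))\<^sup>2 \<le> \<eta>\<^sup>2" by simp
  then show "expectation (\<lambda>\<omega>. \<bar>Z \<omega>\<bar>) \<le> \<eta>" using assms(3) by (rule power2_le_imp_le)
qed

text \<open>Two phases driven by the same noise, of which only the equation for their difference matters.
  The stochastic integrals are specified for each time separately, hence the existential quantifiers
  inside the assumption.\<close>

locale phase_pair = isotropic_noise +
  fixes T \<delta> :: real and \<theta>1 \<theta>2 :: "real \<Rightarrow> 'a \<Rightarrow> real"
  assumes T: "0 < T"
    and adapted_phases: "\<And>t. 0 \<le> t \<Longrightarrow> \<theta>1 t \<in> borel_measurable (F t)"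
      "\<And>t. 0 \<le> t \<Longrightarrow> \<theta>2 t \<in> borel_measurable (F t)"
    and continuous_phases: "AE \<omega> in M. continuous_on {0..T} (\<lambda>t. \<theta>1 t \<omega>)"
      "AE \<omega> in M. continuous_on {0..T} (\<lambda>t. \<theta>2 t \<omega>)"
    and difference_equation: "\<And>t. 0 \<le> t \<Longrightarrow> \<exists>J1 J2.
        has_ito_integral M F W t (\<lambda>s \<omega>. exp (- \<i> * complex_of_real (\<theta>1 s \<omega>))) J1 \<and>
        has_ito_integral M F W t (\<lambda>s \<omega>. exp (- \<i> * complex_of_real (\<theta>2 s \<omega>))) J2 \<and>
        (AE \<omega> in M. \<theta>2 t \<omega> - \<theta>1 t \<omega> = \<delta> * t + Re (J2 \<omega> - J1 \<omega>))"
begin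

definition H1 :: "real \<Rightarrow> 'a \<Rightarrow> complex" where "H1 s \<omega> = exp (- \<i> * complex_of_real (\<theta>1 s \<omega>))"
definition H2 :: "real \<Rightarrow> 'a \<Rightarrow> complex" where "H2 s \<omega> = exp (- \<i> * complex_of_real (\<theta>2 s \<omega>))"
definition X :: "real \<Rightarrow> 'a \<Rightarrow> real" where "X t \<omega> = \<theta>2 t \<omega> - \<theta>1 t \<omega>"

text \<open>The left-endpoint sum for the difference equation. Its coefficients are the true phases at the grid
  points, unlike in an Euler scheme, so convergence to \<open>X\<close> follows from the isometry and needs no
  stability estimate.\<close>

definition Y :: "nat \<Rightarrow> nat \<Rightarrow> 'a \<Rightarrow> real" where
  "Y N k \<omega> = \<delta> * grid T N k +
    Re (simple_integral k (grid T N) (\<lambda>i \<omega>. H2 (grid T N i) \<omega> - H1 (grid T N i) \<omega>) W \<omega>)"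

lemma H_adapted:
  "0 \<le> t \<Longrightarrow> H1 t \<in> borel_measurable (F t)" "0 \<le> t \<Longrightarrow> H2 t \<in> borel_measurable (F t)"
proof -
  have [measurable]: "(\<lambda>x. exp (- \<i> * complex_of_real x)) \<in> borel_measurable borel"
    by (intro borel_measurable_continuous_onI continuous_intros)
  show "0 \<le> t \<Longrightarrow> H1 t \<in> borel_measurable (F t)" "0 \<le> t \<Longrightarrow> H2 t \<in> borel_measurable (F t)"
    using adapted_phases[of t] unfolding H1_def[abs_def] H2_def[abs_def]
    by (auto intro: measurable_compose)
qed

lemma H_norm: "norm (H1 t \<omega>) = 1" "norm (H2 t \<omega>) = 1"
  by (simp_all add: H1_def H2_def norm_exp_eq_Re)

lemma H_continuous:
  "AE \<omega> in M. continuous_on {0..T} (\<lambda>t. H1 t \<omega>)" "AE \<omega> in M. continuous_on {0..T} (\<lambda>t. H2 t \<omega>)"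
  unfolding H1_def H2_def
  by (rule eventually_mono[OF continuous_phases(1)], intro continuous_intros, simp)
     (rule eventually_mono[OF continuous_phases(2)], intro continuous_intros, simp)

lemma ito:
  assumes "0 \<le> t"
  obtains J1 J2 where "has_ito_integral M F W t H1 J1" "has_ito_integral M F W t H2 J2"
    "AE \<omega> in M. X t \<omega> = \<delta> * t + Re (J2 \<omega> - J1 \<omega>)"
  using difference_equation[OF assms] unfolding H1_def[abs_def] H2_def[abs_def] X_def by auto

lemma H_jointly_measurable: "jointly_measurable T H1" "jointly_measurable T H2"
  using T by (auto intro: ito[of T] simp: has_ito_integral_def ito_integrand_def jointly_measurable_def)

lemma X_measurable: "0 \<le> t \<Longrightarrow> X t \<in> borel_measurable M"
  unfolding X_def[abs_def] using F_measurable_M[OF _ adapted_phases(1)] F_measurable_M[OF _ adapted_phases(2)]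
  by auto

lemma Y_0: "Y N 0 \<omega> = 0"
  by (simp add: Y_def simple_integral_def)

lemma Y_Suc: "Y N (Suc k) \<omega> = Y N k \<omega> + (\<delta> * (T / N) +
    Re ((H2 (grid T N k) \<omega> - H1 (grid T N k) \<omega>) * inc (grid T N k) (grid T N (Suc k)) \<omega>))"
proof -
  have "\<delta> * grid T N (Suc k) = \<delta> * grid T N k + \<delta> * (T / N)"
    using grid_step[of T N k] by (metis add_diff_cancel_left' diff_add_cancel distrib_left add.commute)
  then show ?thesis unfolding Y_def simple_integral_def by simp
qed

lemma Y_adapted: "Y N k \<in> borel_measurable (F (grid T N k))"
proof (induction k)
  case 0
  then show ?case by (simp add: Y_0[abs_def])
next
  case (Suc k)
  have g: "0 \<le> grid T N k" "grid T N k \<le> grid T N (Suc k)"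
    using T by (auto intro!: grid_nonneg grid_mono)
  note [measurable] = F_measurable_mono[OF g Suc] F_measurable_mono[OF g H_adapted(1)[OF g(1)]]
    F_measurable_mono[OF g H_adapted(2)[OF g(1)]] inc_measurable_F[OF g]
  show ?case unfolding Y_Suc[abs_def] by measurable
qed

text \<open>Uniformly in \<open>k\<close>, which is what the summation of the one-step estimates requires. The constant 8 in the
  proof is the factor 4 of \<open>ito_integral_simple_error\<close> times the factor 2 from splitting the square
  between the two phases.\<close>

lemma left_endpoint_error:
  assumes "0 < \<eta>"
  shows "\<forall>\<^sub>F N in sequentially. \<forall>k\<le>N.
    integrable M (\<lambda>\<omega>. X (grid T N k) \<omega> - Y N k \<omega>) \<and>
    expectation (\<lambda>\<omega>. \<bar>X (grid T N k) \<omega> - Y N k \<omega>\<bar>) \<le> \<eta>"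
proof -
  define e where "e H N = sq_dist T (simple_value N (grid T N) (\<lambda>i. H (grid T N i))) H" for H N
  have "(\<lambda>N. e H1 N) \<longlonglongrightarrow> 0" "(\<lambda>N. e H2 N) \<longlonglongrightarrow> 0"
    unfolding e_def by (intro sq_dist_grid_tendsto T H_jointly_measurable H_adapted H_continuous;
        simp add: H_norm)+
  then have "(\<lambda>N. 8 * e H2 N + 8 * e H1 N) \<longlonglongrightarrow> 8 * 0 + 8 * 0"
    by (intro tendsto_add ennreal_tendsto_cmult) auto
  then have "\<forall>\<^sub>F N in sequentially. 8 * e H2 N + 8 * e H1 N < ennreal (\<eta>\<^sup>2)"
    using assms by (intro order_tendstoD(2)) auto
  then show ?thesis
    using eventually_gt_at_top[of 0]
  proof (eventually_elim, intro allI impI)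
    fix N k :: nat assume N: "8 * e H2 N + 8 * e H1 N < ennreal (\<eta>\<^sup>2)" "0 < N" "k \<le> N"
    let ?t = "grid T N k"
    have t: "0 \<le> ?t" using T by (auto intro: grid_nonneg)
    obtain J1 J2 where J: "has_ito_integral M F W ?t H1 J1" "has_ito_integral M F W ?t H2 J2"
      "AE \<omega> in M. X ?t \<omega> = \<delta> * ?t + Re (J2 \<omega> - J1 \<omega>)"
      using ito[OF t] by blast
    define S where "S H = simple_integral k (grid T N) (\<lambda>i. H (grid T N i)) W" for H
    have sp: "simple_process M F ?t k (grid T N) (\<lambda>i. H1 (grid T N i))"
      "simple_process M F ?t k (grid T N) (\<lambda>i. H2 (grid T N i))"
      using T N by (auto intro!: grid_simple_process[where C=1] H_adapted simp: H_norm)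
    have err: "(\<integral>\<^sup>+\<omega>. ennreal ((norm (S H1 \<omega> - J1 \<omega>))\<^sup>2) \<partial>M) \<le> 4 * e H1 N"
      "(\<integral>\<^sup>+\<omega>. ennreal ((norm (S H2 \<omega> - J2 \<omega>))\<^sup>2) \<partial>M) \<le> 4 * e H2 N"
      unfolding S_def e_def
      using order_trans[OF ito_integral_simple_error[OF J(1) sp(1)] mult_left_mono[OF sq_dist_grid_prefix]]
        order_trans[OF ito_integral_simple_error[OF J(2) sp(2)] mult_left_mono[OF sq_dist_grid_prefix]]
        T N by auto
    have [measurable]: "S H1 \<in> borel_measurable M" "S H2 \<in> borel_measurable M"
        "J1 \<in> borel_measurable M" "J2 \<in> borel_measurable M"
      using sp[THEN simple_integral_measurable] J by (auto simp: S_def has_ito_integral_def)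
    have Y: "Y N k \<omega> = \<delta> * ?t + Re (S H2 \<omega> - S H1 \<omega>)" for \<omega>
      unfolding Y_def S_def simple_integral_def by (simp add: left_diff_distrib sum_subtractf)
    have "(\<integral>\<^sup>+\<omega>. ennreal ((X ?t \<omega> - Y N k \<omega>)\<^sup>2) \<partial>M) \<le>
        (\<integral>\<^sup>+\<omega>. 2 * ennreal ((norm (S H2 \<omega> - J2 \<omega>))\<^sup>2) + 2 * ennreal ((norm (S H1 \<omega> - J1 \<omega>))\<^sup>2) \<partial>M)"
    proof (rule nn_integral_mono_AE)
      show "AE \<omega> in M. ennreal ((X ?t \<omega> - Y N k \<omega>)\<^sup>2) \<le>
        2 * ennreal ((norm (S H2 \<omega> - J2 \<omega>))\<^sup>2) + 2 * ennreal ((norm (S H1 \<omega> - J1 \<omega>))\<^sup>2)"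
        using J(3)
      proof eventually_elim
        case (elim \<omega>)
        have "X ?t \<omega> - Y N k \<omega> = - Re ((S H2 \<omega> - J2 \<omega>) - (S H1 \<omega> - J1 \<omega>))"
          unfolding elim Y by simp
        then have "(X ?t \<omega> - Y N k \<omega>)\<^sup>2 \<le> (norm ((S H2 \<omega> - J2 \<omega>) - (S H1 \<omega> - J1 \<omega>)))\<^sup>2"
          using abs_Re_le_cmod by (metis abs_le_square_iff abs_minus_cancel abs_norm_cancel)
        then have "ennreal ((X ?t \<omega> - Y N k \<omega>)\<^sup>2)
            \<le> ennreal ((norm ((S H2 \<omega> - J2 \<omega>) - (S H1 \<omega> - J1 \<omega>)))\<^sup>2)"
          by (rule ennreal_leI)
        also have "\<dots> \<le> 2 * ennreal ((norm (S H2 \<omega> - J2 \<omega>))\<^sup>2) + 2 * ennreal ((norm (S H1 \<omega> - J1 \<omega>))\<^sup>2)"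
          using norm_diff_square_le[of "S H2 \<omega> - J2 \<omega>" "S H1 \<omega> - J1 \<omega>" 0] by (simp add: norm_minus_commute)
        finally show ?case .
      qed
    qed
    also have "\<dots> = 2 * (\<integral>\<^sup>+\<omega>. ennreal ((norm (S H2 \<omega> - J2 \<omega>))\<^sup>2) \<partial>M)
        + 2 * (\<integral>\<^sup>+\<omega>. ennreal ((norm (S H1 \<omega> - J1 \<omega>))\<^sup>2) \<partial>M)"
      by (subst nn_integral_add) (auto simp: nn_integral_cmult)
    also have "\<dots> \<le> 2 * (4 * e H2 N) + 2 * (4 * e H1 N)"
      by (intro add_mono mult_left_mono err) auto
    also have "\<dots> \<le> ennreal (\<eta>\<^sup>2)"
      using N(1) by (simp add: mult.assoc[symmetric])
    finally have *: "(\<integral>\<^sup>+\<omega>. ennreal ((X ?t \<omega> - Y N k \<omega>)\<^sup>2) \<partial>M) \<le> ennreal (\<eta>\<^sup>2)" .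
    have "(\<lambda>\<omega>. X ?t \<omega> - Y N k \<omega>) \<in> borel_measurable M"
      using X_measurable[OF t] F_measurable_M[OF t Y_adapted] by auto
    from L1_le_L2[OF this *] assms
    show "integrable M (\<lambda>\<omega>. X ?t \<omega> - Y N k \<omega>) \<and> expectation (\<lambda>\<omega>. \<bar>X ?t \<omega> - Y N k \<omega>\<bar>) \<le> \<eta>"
      by simp
  qed
qed

text \<open>Iterating \<open>expectation_one_step\<close> over the \<open>N\<close> cells multiplies \<open>g 0\<close> by at most
  \<open>(1 + c * T / N) ^ N \<le> exp (c * T)\<close> and accumulates the error \<open>N * b \<eta> N\<close>, which tends to
  \<open>K * T * \<eta>\<close>; finally \<open>\<eta>\<close> tends to 0.\<close>

lemma dynkin_inequality:
  assumes "test_function g g1 g2 K \<delta> c"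
  shows "expectation (\<lambda>\<omega>. g (\<theta>2 T \<omega> - \<theta>1 T \<omega>)) \<le> exp (c * T) * g 0"
proof -
  interpret test_function g g1 g2 K \<delta> c by fact
  define b where "b \<eta> N = K * (T / real N) * \<eta> + K * ((T / real N)\<^sup>2 * \<delta>\<^sup>2 + 4 * (\<delta> * (T / real N)) ^ 3
      + 64 * (T / real N) * sqrt (T / real N))" for \<eta> N
  have iX: "integrable M (\<lambda>\<omega>. g (X T \<omega>))"
    using X_measurable[of T] T bounded_test by (auto intro!: integrable_const_bound[where B=K])
  have main: "\<forall>\<^sub>F N in sequentially. expectation (\<lambda>\<omega>. g (X T \<omega>)) \<le>
      exp (c * T) * (g 0 + real N * b \<eta> N) + K * \<eta>" if \<eta>: "0 < \<eta>" for \<eta>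
    using left_endpoint_error[OF \<eta>] eventually_gt_at_top[of 0]
  proof eventually_elim
    fix N :: nat
    assume err: "\<forall>k\<le>N. integrable M (\<lambda>\<omega>. X (grid T N k) \<omega> - Y N k \<omega>) \<and>
      expectation (\<lambda>\<omega>. \<bar>X (grid T N k) \<omega> - Y N k \<omega>\<bar>) \<le> \<eta>" and N: "0 < N"
    define h where "h = T / real N"
    have h: "0 < h" using T N by (simp add: h_def)
    have b0: "0 \<le> b \<eta> N" using K_nonneg drift_nonneg \<eta> h unfolding b_def h_def[symmetric] by simp
    define a where "a k = expectation (\<lambda>\<omega>. g (Y N k \<omega>))" for k
    have "a (Suc k) \<le> (1 + c * h) * a k + b \<eta> N" if "k < N" for k
    proof -
      have st: "0 \<le> grid T N k" "grid T N k < grid T N (Suc k)" "h = grid T N (Suc k) - grid T N k"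
        using grid_step[of T N k] h T by (auto simp: h_def intro!: grid_nonneg)
      have "a (Suc k) \<le> (1 + c * h) * a k + K * h * expectation (\<lambda>\<omega>. \<bar>X (grid T N k) \<omega> - Y N k \<omega>\<bar>)
        + K * (h\<^sup>2 * \<delta>\<^sup>2 + 4 * (\<delta> * h) ^ 3 + 64 * h * sqrt h)"
        unfolding a_def Y_Suc h_def[symmetric]
      proof (rule expectation_one_step[OF assms st(1,2,3) Y_adapted])
        show "(\<lambda>\<omega>. H2 (grid T N k) \<omega> - H1 (grid T N k) \<omega>) \<in> borel_measurable (F (grid T N k))"
          using H_adapted[OF st(1)] by auto
        show "integrable M (\<lambda>\<omega>. X (grid T N k) \<omega> - Y N k \<omega>)" using err that by auto
        show "(norm (H2 (grid T N k) \<omega> - H1 (grid T N k) \<omega>))\<^sup>2 = 4 * (sin (X (grid T N k) \<omega> / 2))\<^sup>2" for \<omega>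
          unfolding H1_def H2_def X_def by (rule norm_phase_diff_square)
      qed (rule X_measurable[OF st(1)])
      also have "\<dots> \<le> (1 + c * h) * a k + b \<eta> N"
        using mult_left_mono[of "expectation (\<lambda>\<omega>. \<bar>X (grid T N k) \<omega> - Y N k \<omega>\<bar>)" \<eta> "K * h"]
          err that K_nonneg h unfolding b_def h_def[symmetric] by simp
      finally show ?thesis .
    qed
    from affine_recursion_le[of N a, OF this _ b0, of N]
    have "a N \<le> (1 + c * h) ^ N * (a 0 + real N * b \<eta> N)"
      using h rate_nonneg by simp
    also have "a 0 = g 0" by (simp add: a_def Y_0 prob_space)
    also have "(1 + c * h) ^ N * (g 0 + real N * b \<eta> N) \<le> exp (c * T) * (g 0 + real N * b \<eta> N)"
    proof (rule mult_right_mono)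
      have "(1 + c * h) ^ N \<le> exp (c * h) ^ N"
        using exp_ge_add_one_self[of "c * h"] h rate_nonneg by (intro power_mono) auto
      also have "\<dots> = exp (c * T)" using N by (simp add: exp_of_nat_mult[symmetric] h_def)
      finally show "(1 + c * h) ^ N \<le> exp (c * T)" .
    qed (use b0 test_nonneg in simp)
    finally have aN: "a N \<le> exp (c * T) * (g 0 + real N * b \<eta> N)" .
    have eN: "integrable M (\<lambda>\<omega>. X T \<omega> - Y N N \<omega>)" "expectation (\<lambda>\<omega>. \<bar>X T \<omega> - Y N N \<omega>\<bar>) \<le> \<eta>"
      using err[rule_format, of N] N by auto
    have iY: "integrable M (\<lambda>\<omega>. g (Y N N \<omega>))"
      using F_measurable_M[OF _ Y_adapted, of N N] T bounded_test grid_nonneg[of T N N]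
      by (auto intro!: integrable_const_bound[where B=K])
    have "expectation (\<lambda>\<omega>. g (X T \<omega>)) \<le> expectation (\<lambda>\<omega>. g (Y N N \<omega>) + K * \<bar>X T \<omega> - Y N N \<omega>\<bar>)"
    proof (rule integral_mono)
      show "g (X T \<omega>) \<le> g (Y N N \<omega>) + K * \<bar>X T \<omega> - Y N N \<omega>\<bar>" for \<omega>
        using lipschitz[of "X T \<omega>" "Y N N \<omega>"] by linarith
    qed (use iX iY eN in auto)
    also have "\<dots> = a N + K * expectation (\<lambda>\<omega>. \<bar>X T \<omega> - Y N N \<omega>\<bar>)"
      using iY eN by (simp add: a_def)
    also have "\<dots> \<le> exp (c * T) * (g 0 + real N * b \<eta> N) + K * \<eta>"
      by (intro add_mono aN mult_left_mono eN K_nonneg)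
    finally show "expectation (\<lambda>\<omega>. g (X T \<omega>)) \<le> exp (c * T) * (g 0 + real N * b \<eta> N) + K * \<eta>" .
  qed
  have lim: "(\<lambda>N. real N * b \<eta> N) \<longlonglongrightarrow> K * T * \<eta>" for \<eta>
  proof -
    have h0: "(\<lambda>N. T / real N) \<longlonglongrightarrow> 0" by (rule lim_const_over_n)
    have "(\<lambda>N. K * T * (\<eta> + (T / real N) * \<delta>\<^sup>2 + 4 * \<delta> ^ 3 * (T / real N)\<^sup>2 + 64 * sqrt (T / real N)))
        \<longlonglongrightarrow> K * T * (\<eta> + 0 * \<delta>\<^sup>2 + 4 * \<delta> ^ 3 * 0\<^sup>2 + 64 * sqrt 0)"
      by (intro tendsto_intros h0)
    then have "(\<lambda>N. K * T * (\<eta> + (T / real N) * \<delta>\<^sup>2 + 4 * \<delta> ^ 3 * (T / real N)\<^sup>2 + 64 * sqrt (T / real N)))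
        \<longlonglongrightarrow> K * T * \<eta>" by simp
    then show ?thesis
    proof (rule Lim_transform_eventually)
      show "\<forall>\<^sub>F N in sequentially. K * T * (\<eta> + (T / real N) * \<delta>\<^sup>2 + 4 * \<delta> ^ 3 * (T / real N)\<^sup>2 +
          64 * sqrt (T / real N)) = real N * b \<eta> N"
        using eventually_gt_at_top[of 0]
      proof eventually_elim
        case (elim N)
        define h where "h = T / real N"
        have T: "T = real N * h" using elim by (simp add: h_def)
        show ?case unfolding b_def h_def[symmetric] unfolding T
          by (simp add: power2_eq_square power3_eq_cube algebra_simps)
      qed
    qed
  qed
  have "expectation (\<lambda>\<omega>. g (X T \<omega>)) \<le> exp (c * T) * (g 0 + K * T * \<eta>) + K * \<eta>" if "0 < \<eta>" for \<eta>
    by (rule tendsto_lowerbound[OF _ main[OF that]]) (intro tendsto_intros lim, simp)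
  then have "\<forall>\<^sub>F \<eta> in at_right 0. expectation (\<lambda>\<omega>. g (X T \<omega>)) \<le> exp (c * T) * (g 0 + K * T * \<eta>) + K * \<eta>"
    by (auto simp: eventually_at_filter)
  moreover have "((\<lambda>\<eta>. exp (c * T) * (g 0 + K * T * \<eta>) + K * \<eta>) \<longlongrightarrow>
      exp (c * T) * (g 0 + K * T * 0) + K * 0) (at_right 0)"
    by (intro tendsto_intros)
  ultimately have "expectation (\<lambda>\<omega>. g (X T \<omega>)) \<le> exp (c * T) * (g 0 + K * T * 0) + K * 0"
    by (intro tendsto_lowerbound) auto
  then show ?thesis by (simp add: X_def)
qed

end

section \<open>A saturated power as test function\<close>

text \<open>The building block of the logarithmic derivative of the test function, with its first two
  derivatives; all three are bounded.\<close>

definition quad_ratio :: "real \<Rightarrow> real \<Rightarrow> real" where "quad_ratio A x = x / (x\<^sup>2 + A)"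
definition quad_ratio1 :: "real \<Rightarrow> real \<Rightarrow> real" where "quad_ratio1 A x = (A - x\<^sup>2) / (x\<^sup>2 + A)\<^sup>2"
definition quad_ratio2 :: "real \<Rightarrow> real \<Rightarrow> real" where "quad_ratio2 A x = 2 * x * (x\<^sup>2 - 3 * A) / (x\<^sup>2 + A) ^ 3"

lemma pos_quadratic: "0 < A \<Longrightarrow> 0 < x\<^sup>2 + (A::real)"
  by (simp add: add_nonneg_pos)

lemma DERIV_quad_ratio:
  assumes "0 < A"
  shows "(quad_ratio A has_real_derivative quad_ratio1 A x) (at x)"
    "(quad_ratio1 A has_real_derivative quad_ratio2 A x) (at x)"
proof -
  have q: "0 < x\<^sup>2 + A" using pos_quadratic[OF assms] .
  show "(quad_ratio A has_real_derivative quad_ratio1 A x) (at x)"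
    unfolding quad_ratio_def[abs_def] quad_ratio1_def using q
    by (auto intro!: derivative_eq_intros simp: power2_eq_square)
  define q where "q = x\<^sup>2 + A"
  have A: "A = q - x\<^sup>2" "q \<noteq> 0" using q by (auto simp: q_def)
  have "(quad_ratio1 A has_real_derivative (- (2 * x) * q\<^sup>2 - (A - x\<^sup>2) * (2 * q * (2 * x))) / (q\<^sup>2 * q\<^sup>2)) (at x)"
    unfolding quad_ratio1_def[abs_def] q_def using q
    by (auto intro!: derivative_eq_intros simp: power2_eq_square)
  also have "(- (2 * x) * q\<^sup>2 - (A - x\<^sup>2) * (2 * q * (2 * x))) / (q\<^sup>2 * q\<^sup>2) = quad_ratio2 A x"
    unfolding quad_ratio2_def q_def[symmetric] using A(2) unfolding A(1)
    by (simp add: divide_simps) (simp add: eval_nat_numeral algebra_simps)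
  finally show "(quad_ratio1 A has_real_derivative quad_ratio2 A x) (at x)" .
qed

lemma quad_ratio1_le: "0 < A \<Longrightarrow> \<bar>quad_ratio1 A x\<bar> \<le> 1 / (x\<^sup>2 + A)"
proof -
  assume A: "0 < A"
  have "\<bar>A - x\<^sup>2\<bar> \<le> x\<^sup>2 + A" using A by (auto simp: abs_le_iff)
  then have "\<bar>A - x\<^sup>2\<bar> / (x\<^sup>2 + A)\<^sup>2 \<le> (x\<^sup>2 + A) / (x\<^sup>2 + A)\<^sup>2" by (intro divide_right_mono) auto
  then show ?thesis using pos_quadratic[OF A, of x]
    by (simp add: quad_ratio1_def power2_eq_square)
qed

lemma bounded_quad_ratio:
  assumes "0 < A"
  shows "\<exists>C. \<forall>x. \<bar>quad_ratio A x\<bar> \<le> C" "\<exists>C. \<forall>x. \<bar>quad_ratio1 A x\<bar> \<le> C" "\<exists>C. \<forall>x. \<bar>quad_ratio2 A x\<bar> \<le> C"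
proof -
  have q: "0 < x\<^sup>2 + A" "1 / (x\<^sup>2 + A) \<le> 1 / A" for x
    using pos_quadratic[OF assms, of x] assms by (auto simp: field_simps)
  have 0: "\<bar>quad_ratio A x\<bar> \<le> 1 + 1 / A" for x
  proof -
    have "\<bar>x\<bar> \<le> 1 + x\<^sup>2" using sum_squares_bound[of 1 "\<bar>x\<bar>"] by simp
    then have "\<bar>quad_ratio A x\<bar> \<le> (1 + x\<^sup>2) / (x\<^sup>2 + A)"
      using q(1)[of x] by (simp add: quad_ratio_def divide_right_mono)
    also have "\<dots> \<le> 1 + 1 / (x\<^sup>2 + A)"
      using q(1)[of x] assms by (simp add: field_simps)
    finally show ?thesis using q(2)[of x] by linarith
  qed
  then show "\<exists>C. \<forall>x. \<bar>quad_ratio A x\<bar> \<le> C" by blast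
  have "\<bar>quad_ratio1 A x\<bar> \<le> 1 / A" for x
    using quad_ratio1_le[OF assms, of x] q(2)[of x] by linarith
  then show "\<exists>C. \<forall>x. \<bar>quad_ratio1 A x\<bar> \<le> C" by blast
  have "\<bar>quad_ratio2 A x\<bar> \<le> 6 * (1 + 1 / A) * (1 / A)" for x
  proof -
    have "\<bar>x\<^sup>2 - 3 * A\<bar> \<le> 3 * (x\<^sup>2 + A)" using assms by (auto simp: abs_le_iff)
    then have "2 * \<bar>x\<bar> * \<bar>x\<^sup>2 - 3 * A\<bar> \<le> 2 * \<bar>x\<bar> * (3 * (x\<^sup>2 + A))" by (intro mult_left_mono) auto
    then have "2 * \<bar>x\<bar> * \<bar>x\<^sup>2 - 3 * A\<bar> / (x\<^sup>2 + A) ^ 3 \<le> 2 * \<bar>x\<bar> * (3 * (x\<^sup>2 + A)) / (x\<^sup>2 + A) ^ 3"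
      using q(1)[of x] by (intro divide_right_mono) auto
    also have "\<dots> = 6 * \<bar>quad_ratio A x\<bar> * (1 / (x\<^sup>2 + A))"
    proof -
      have "2 * \<bar>x\<bar> * (3 * q) / q ^ 3 = 6 * (\<bar>x\<bar> / q) * (1 / q)" if "0 < q" for q
        using that by (simp add: power3_eq_cube)
      from this[OF q(1)[of x]] show ?thesis using q(1)[of x] by (simp add: quad_ratio_def)
    qed
    also have "\<dots> \<le> 6 * (1 + 1 / A) * (1 / A)"
      using 0[of x] q[of x] by (intro mult_mono) auto
    finally show ?thesis using q(1)[of x] by (simp add: quad_ratio2_def abs_mult)
  qed
  then show "\<exists>C. \<forall>x. \<bar>quad_ratio2 A x\<bar> \<le> C" by blast
qed

text \<open>The bound on the third derivative gives the Taylor remainder, the one on the first derivative the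
  Lipschitz constant.\<close>

lemma test_functionI:
  fixes g g1 g2 g3 :: "real \<Rightarrow> real"
  assumes d: "\<And>x. (g has_real_derivative g1 x) (at x)" "\<And>x. (g1 has_real_derivative g2 x) (at x)"
      "\<And>x. (g2 has_real_derivative g3 x) (at x)"
    and b: "\<exists>C. \<forall>x. \<bar>g x\<bar> \<le> C" "\<exists>C. \<forall>x. \<bar>g1 x\<bar> \<le> C" "\<exists>C. \<forall>x. \<bar>g2 x\<bar> \<le> C" "\<exists>C. \<forall>x. \<bar>g3 x\<bar> \<le> C"
    and "\<And>x z. 0 \<le> z \<Longrightarrow> z \<le> x\<^sup>2 / 4 \<Longrightarrow> \<delta> * g1 x + z * g2 x \<le> c * g x"
    and "0 \<le> \<delta>" "\<And>x. 0 \<le> g x" "0 \<le> c"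
  shows "\<exists>K. test_function g g1 g2 K \<delta> c"
proof -
  from b obtain C0 C1 C2 C3 where C: "\<And>x. \<bar>g x\<bar> \<le> C0" "\<And>x. \<bar>g1 x\<bar> \<le> C1" "\<And>x. \<bar>g2 x\<bar> \<le> C2" "\<And>x. \<bar>g3 x\<bar> \<le> C3"
    by metis
  define K where "K = Max {C0, C1, C2, C3}"
  have CK: "C0 \<le> K" "C1 \<le> K" "C2 \<le> K" "C3 \<le> K" by (auto simp: K_def)
  note K = C(1)[THEN order_trans, OF CK(1)] C(2)[THEN order_trans, OF CK(2)]
    C(3)[THEN order_trans, OF CK(3)] C(4)[THEN order_trans, OF CK(4)]
  have meas: "g \<in> borel_measurable borel" "g1 \<in> borel_measurable borel" "g2 \<in> borel_measurable borel"
    using d by (auto intro!: borel_measurable_continuous_onI continuous_at_imp_continuous_on DERIV_isCont)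
  have taylor: "g (x + r) \<le> g x + g1 x * r + g2 x / 2 * r\<^sup>2 + K * \<bar>r\<bar> ^ 3" for x r
  proof -
    define D where "D m = (\<lambda>y. (if m = 0 then g else if m = 1 then g1 else if m = 2 then g2 else g3) (x + y))" for m :: nat
    have "\<exists>t. \<bar>t\<bar> \<le> \<bar>r\<bar> \<and> (\<lambda>y. g (x + y)) r = (\<Sum>m<3. D m 0 / fact m * r ^ m) + D 3 t / fact 3 * r ^ 3"
    proof (rule Maclaurin_bi_le)
      have sh: "((\<lambda>y. f (x + y)) has_real_derivative f' (x + t)) (at t)"
        if "\<And>y. (f has_real_derivative f' y) (at y)" for f f' t
        using that[of "x + t"] DERIV_shift[of f "f' (x + t)" t x] by (simp add: add.commute)
      show "\<forall>m t. m < 3 \<and> \<bar>t\<bar> \<le> \<bar>r\<bar> \<longrightarrow> (D m has_real_derivative D (Suc m) t) (at t)"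
        using sh[OF d(1)] sh[OF d(2)] sh[OF d(3)] by (auto simp: D_def less_Suc_eq numeral_3_eq_3)
    qed (simp add: D_def)
    then obtain t where "g (x + r) = (\<Sum>m<3. D m 0 / fact m * r ^ m) + D 3 t / fact 3 * r ^ 3" by auto
    then have t: "g (x + r) = g x + g1 x * r + g2 x / 2 * r\<^sup>2 + g3 (x + t) / 6 * r ^ 3"
      by (simp add: D_def numeral_3_eq_3 power2_eq_square fact_reduce)
    have "g3 (x + t) * r ^ 3 \<le> K * \<bar>r\<bar> ^ 3"
      using mult_right_mono[OF K(4)[of "x + t"], of "\<bar>r\<bar> ^ 3"] abs_ge_self[of "g3 (x + t) * r ^ 3"]
      by (simp add: abs_mult power_abs)
    moreover have "0 \<le> K * \<bar>r\<bar> ^ 3" using K(1)[of 0] by auto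
    ultimately show ?thesis unfolding t by simp
  qed
  have lip: "\<bar>g x - g y\<bar> \<le> K * \<bar>x - y\<bar>" for x y
    using field_differentiable_bound[of UNIV g g1 K x y] d(1) K(2) by simp
  have "test_function g g1 g2 K \<delta> c"
    by unfold_locales (use meas K taylor lip assms(8-) in auto)
  then show ?thesis by blast
qed

lemma bounded_fun_mult:
  fixes f g :: "real \<Rightarrow> real"
  assumes "\<exists>C. \<forall>x. \<bar>f x\<bar> \<le> C" "\<exists>C. \<forall>x. \<bar>g x\<bar> \<le> C"
  shows "\<exists>C. \<forall>x. \<bar>f x * g x\<bar> \<le> C"
proof -
  from assms obtain C D where C: "\<And>x. \<bar>f x\<bar> \<le> C" "\<And>x. \<bar>g x\<bar> \<le> D" by blast
  have "\<bar>f x * g x\<bar> \<le> C * D" for x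
    unfolding abs_mult using C(1)[of x] C(2)[of x] by (intro mult_mono) auto
  then show ?thesis by blast
qed

lemma bounded_fun_add:
  fixes f g :: "real \<Rightarrow> real"
  assumes "\<exists>C. \<forall>x. \<bar>f x\<bar> \<le> C" "\<exists>C. \<forall>x. \<bar>g x\<bar> \<le> C"
  shows "\<exists>C. \<forall>x. \<bar>f x + g x\<bar> \<le> C" "\<exists>C. \<forall>x. \<bar>f x - g x\<bar> \<le> C"
proof -
  from assms obtain C D where C: "\<And>x. \<bar>f x\<bar> \<le> C" "\<And>x. \<bar>g x\<bar> \<le> D" by blast
  have "\<bar>f x + g x\<bar> \<le> C + D" "\<bar>f x - g x\<bar> \<le> C + D" for x
    using C(1)[of x] C(2)[of x] by linarith+
  then show "\<exists>C. \<forall>x. \<bar>f x + g x\<bar> \<le> C" "\<exists>C. \<forall>x. \<bar>f x - g x\<bar> \<le> C" by blast+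
qed

lemma bounded_fun_const: "\<exists>C. \<forall>x::real. \<bar>a::real\<bar> \<le> C" by blast

text \<open>The logarithm of the square root of \<open>q / (1 + q / 2)\<close> for \<open>q = x\<^sup>2 + \<delta>\<^sup>2\<close>. Adding \<open>\<delta>\<^sup>2\<close> removes the
  singularity at 0 on the scale where the drift takes over. The saturation \<open>q / (1 + q / 2)\<close> makes the
  function bounded; it is increasing and has a slope smaller than that of \<open>q\<close> on the logarithmic
  scale, so it does not spoil the differential inequality, and the constant \<open>1 / 2\<close> leaves the value at
  \<open>2 * pi\<close> above 1.\<close>

definition log_saturation :: "real \<Rightarrow> real \<Rightarrow> real" where
  "log_saturation \<delta> x = (ln 2 + ln (x\<^sup>2 + \<delta>\<^sup>2) - ln (x\<^sup>2 + (\<delta>\<^sup>2 + 2))) / 2"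

definition saturated_power :: "real \<Rightarrow> real \<Rightarrow> real \<Rightarrow> real" where
  "saturated_power \<delta> a x = exp (a * log_saturation \<delta> x)"

lemma saturated_power_ge_1:
  assumes "0 \<le> a" "2 * pi \<le> x"
  shows "1 \<le> saturated_power \<delta> a x"
proof -
  have "2 \<le> x" using pi_gt3 assms by linarith
  then have "2\<^sup>2 \<le> x\<^sup>2" by (intro power_mono) auto
  then have q: "2 \<le> x\<^sup>2 + \<delta>\<^sup>2" by (simp add: add_increasing2)
  have "ln (x\<^sup>2 + (\<delta>\<^sup>2 + 2)) \<le> ln (2 * (x\<^sup>2 + \<delta>\<^sup>2))" using q by (subst ln_le_cancel_iff) auto
  also have "\<dots> = ln 2 + ln (x\<^sup>2 + \<delta>\<^sup>2)" using q by (intro ln_mult_pos) auto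
  finally show ?thesis using assms by (simp add: saturated_power_def log_saturation_def)
qed

lemma saturated_power_0:
  assumes "0 < \<delta>" "0 \<le> a"
  shows "saturated_power \<delta> a 0 \<le> exp (a * ln \<delta>)"
proof -
  have "ln 2 \<le> ln (\<delta>\<^sup>2 + 2)" by (subst ln_le_cancel_iff) (auto simp: add_nonneg_pos)
  then have "log_saturation \<delta> 0 \<le> ln \<delta>"
    using assms by (simp add: log_saturation_def ln_realpow)
  then show ?thesis using assms by (simp add: saturated_power_def mult_left_mono)
qed

text \<open>With \<open>k\<close> the derivative of \<open>log_saturation \<delta>\<close>, the generator applied to the power, divided by the power,
  is \<open>a * (\<delta> * k) + a\<^sup>2 * (z * k\<^sup>2) + a * (z * k')\<close>. Since \<open>\<bar>k\<bar> \<le> \<bar>x\<bar> / q\<close>, \<open>\<bar>k'\<bar> \<le> 2 / q\<close> and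
  \<open>z \<le> x\<^sup>2 / 4 \<le> q / 4\<close>, the three brackets are at most \<open>1 / 2\<close>, \<open>1 / 4\<close> and \<open>1 / 2\<close>.\<close>

lemma saturated_power_test_function:
  assumes \<delta>: "0 < \<delta>" and a: "0 \<le> a"
  shows "\<exists>g1 g2 K. test_function (saturated_power \<delta> a) g1 g2 K \<delta> (a\<^sup>2 / 4 + a)"
proof -
  define A where "A = \<delta>\<^sup>2"
  have A: "0 < A" "0 < A + 2" using \<delta> by (auto simp: A_def intro: add_pos_pos)
  define k k1 k2 where "k x = quad_ratio A x - quad_ratio (A + 2) x" and "k1 x = quad_ratio1 A x - quad_ratio1 (A + 2) x"
    and "k2 x = quad_ratio2 A x - quad_ratio2 (A + 2) x" for x
  define g where "g = saturated_power \<delta> a"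
  define g1 g2 g3 where "g1 x = a * (g x * k x)" and "g2 x = a * (g x * (a * (k x * k x) + k1 x))"
    and "g3 x = a * (g x * (a * (a * (k x * (k x * k x))) + a * (3 * (k x * k1 x)) + k2 x))" for x
  have dk: "(k has_real_derivative k1 x) (at x)" "(k1 has_real_derivative k2 x) (at x)" for x
    unfolding k_def[abs_def] k1_def[abs_def] k2_def[abs_def]
    by (intro DERIV_diff DERIV_quad_ratio A)+
  have dl: "(log_saturation \<delta> has_real_derivative k x) (at x)" for x
  proof -
    have "(log_saturation \<delta> has_real_derivative
        (2 * x / (x\<^sup>2 + A) - 2 * x / (x\<^sup>2 + (A + 2))) / 2) (at x)"
      unfolding log_saturation_def[abs_def] A_def[symmetric]
      using pos_quadratic[OF A(1), of x] pos_quadratic[OF A(2), of x]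
      by (auto intro!: derivative_eq_intros simp del: distrib_left_numeral distrib_right_numeral)
    also have "(2 * x / p - 2 * x / q) / 2 = x / p - x / q" for p q
      by (simp add: diff_divide_distrib)
    finally show ?thesis unfolding k_def quad_ratio_def .
  qed
  have d1: "(g has_real_derivative g1 x) (at x)" for x
    unfolding g_def g1_def saturated_power_def[abs_def]
    by (rule derivative_eq_intros dl refl)+ (simp add: algebra_simps)
  have d2: "(g1 has_real_derivative g2 x) (at x)" for x
    unfolding g1_def[abs_def]
    by (rule derivative_eq_intros d1 dk refl)+ (simp add: g2_def g1_def algebra_simps)
  have d3: "(g2 has_real_derivative g3 x) (at x)" for x
    unfolding g2_def[abs_def]
    by (rule derivative_eq_intros d1 dk refl)+ (simp add: g3_def g1_def algebra_simps)
  have g0: "0 < g x" for x by (simp add: g_def saturated_power_def)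
  have bg: "\<exists>C. \<forall>x. \<bar>g x\<bar> \<le> C"
  proof -
    have "log_saturation \<delta> x \<le> 1" for x
    proof -
      have "ln (x\<^sup>2 + \<delta>\<^sup>2) \<le> ln (x\<^sup>2 + (\<delta>\<^sup>2 + 2))"
        using pos_quadratic[OF A(1), of x] by (subst ln_le_cancel_iff) (auto simp: A_def)
      moreover have "ln (2::real) \<le> 1" using ln_le_minus_one[of 2] by simp
      ultimately show ?thesis by (simp add: log_saturation_def)
    qed
    then have "\<bar>g x\<bar> \<le> exp (a * 1)" for x
      unfolding g_def saturated_power_def using a by (simp add: mult_left_le)
    then show ?thesis by blast
  qed
  have bk: "\<exists>C. \<forall>x. \<bar>k x\<bar> \<le> C" "\<exists>C. \<forall>x. \<bar>k1 x\<bar> \<le> C" "\<exists>C. \<forall>x. \<bar>k2 x\<bar> \<le> C"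
    unfolding k_def k1_def k2_def by (intro bounded_fun_add bounded_quad_ratio A)+
  have b: "\<exists>C. \<forall>x. \<bar>g1 x\<bar> \<le> C" "\<exists>C. \<forall>x. \<bar>g2 x\<bar> \<le> C" "\<exists>C. \<forall>x. \<bar>g3 x\<bar> \<le> C"
    unfolding g1_def g2_def g3_def
    by (intro bounded_fun_mult bounded_fun_add bounded_fun_const bg bk)+
  have gen: "\<delta> * g1 x + z * g2 x \<le> (a\<^sup>2 / 4 + a) * g x" if z: "0 \<le> z" "z \<le> x\<^sup>2 / 4" for x z
  proof -
    define q where "q = x\<^sup>2 + A"
    have q: "0 < q" "x\<^sup>2 \<le> q" "x\<^sup>2 + (A + 2) = q + 2"
      using pos_quadratic[OF A(1), of x] A by (auto simp: q_def)
    have k: "k x = x / q * (2 / (q + 2))"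
      unfolding k_def quad_ratio_def q(3) q_def[symmetric] using q(1) by (simp add: field_simps)
    have "0 \<le> 2 / (q + 2)" "2 / (q + 2) \<le> 1" using q(1) by (auto simp: field_simps)
    then have ka: "\<bar>k x\<bar> \<le> \<bar>x\<bar> / q"
      unfolding k abs_mult using q(1) mult_left_mono[of "2 / (q + 2)" 1 "\<bar>x / q\<bar>"] by simp
    have "\<delta> * \<bar>k x\<bar> \<le> \<delta> * (\<bar>x\<bar> / q)" using ka \<delta> by (intro mult_left_mono) auto
    also have "\<dots> \<le> 1 / 2"
      using sum_squares_bound[of \<delta> "\<bar>x\<bar>"] q(1) by (simp add: field_simps q_def A_def)
    finally have 1: "\<delta> * k x \<le> 1 / 2"
      using mult_left_mono[OF abs_ge_self[of "k x"], of \<delta>] \<delta> by linarith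
    have "(k x)\<^sup>2 \<le> (\<bar>x\<bar> / q)\<^sup>2" using ka power_mono[of "\<bar>k x\<bar>" "\<bar>x\<bar> / q" 2] by simp
    then have "z * (k x)\<^sup>2 \<le> (x\<^sup>2 / 4) * (\<bar>x\<bar> / q)\<^sup>2" using z by (intro mult_mono) auto
    also have "\<dots> = (x\<^sup>2 / q)\<^sup>2 / 4" by (simp add: power_divide power2_eq_square)
    also have "\<dots> \<le> 1 / 4" using q power_mono[of "x\<^sup>2 / q" 1 2] by simp
    finally have 2: "z * (k x)\<^sup>2 \<le> 1 / 4" .
    have "\<bar>k1 x\<bar> \<le> 1 / q + 1 / (q + 2)"
      using quad_ratio1_le[OF A(1), of x] quad_ratio1_le[OF A(2), of x] unfolding k1_def q(3) q_def[symmetric] by linarith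
    also have "\<dots> \<le> 2 / q" using q(1) frac_le[of 1 1 q "q + 2"] by simp
    finally have "z * \<bar>k1 x\<bar> \<le> (x\<^sup>2 / 4) * (2 / q)" using z by (intro mult_mono) auto
    also have "\<dots> \<le> 1 / 2" using q by (simp add: field_simps)
    finally have 3: "z * k1 x \<le> 1 / 2"
      using mult_left_mono[OF abs_ge_self[of "k1 x"], of z] z by linarith
    have "\<delta> * g1 x + z * g2 x = (a * (\<delta> * k x) + a\<^sup>2 * (z * (k x)\<^sup>2) + a * (z * k1 x)) * g x"
      by (simp add: g1_def g2_def power2_eq_square algebra_simps)
    also have "\<dots> \<le> (a * (1 / 2) + a\<^sup>2 * (1 / 4) + a * (1 / 2)) * g x"
      using a 1 2 3 g0[of x] by (intro mult_right_mono add_mono mult_left_mono) auto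
    finally show ?thesis by (simp add: algebra_simps)
  qed
  have "\<exists>K. test_function g g1 g2 K \<delta> (a\<^sup>2 / 4 + a)"
    using \<delta> a g0 by (intro test_functionI[OF d1 d2 d3 bg b gen]) (auto intro: less_imp_le)
  then show ?thesis unfolding g_def by blast
qed

section \<open>Brownian motions drive isotropic noise\<close>

lemma brownian_increment_moments:
  assumes "prob_space M" "standard_brownian_motion M X" "0 \<le> s" "s \<le> t"
  shows "has_bochner_integral M (\<lambda>\<omega>. X t \<omega> - X s \<omega>) 0"
    and "has_bochner_integral M (\<lambda>\<omega>. (X t \<omega> - X s \<omega>)\<^sup>2) (t - s)"
    and "has_bochner_integral M (\<lambda>\<omega>. (X t \<omega> - X s \<omega>) ^ 4) (3 * (t - s)\<^sup>2)"
proof -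
  have "has_bochner_integral M (\<lambda>\<omega>. X t \<omega> - X s \<omega>) 0 \<and>
    has_bochner_integral M (\<lambda>\<omega>. (X t \<omega> - X s \<omega>)\<^sup>2) (t - s) \<and>
    has_bochner_integral M (\<lambda>\<omega>. (X t \<omega> - X s \<omega>) ^ 4) (3 * (t - s)\<^sup>2)"
  proof (cases "s = t")
    case True
    then show ?thesis by (simp add: has_bochner_integral_zero)
  next
    case False
    define \<sigma> where "\<sigma> = sqrt (t - s)"
    have \<sigma>: "0 < \<sigma>" "\<sigma>\<^sup>2 = t - s" using False assms by (auto simp: \<sigma>_def)
    have D: "distributed M lborel (\<lambda>\<omega>. X t \<omega> - X s \<omega>) (normal_density 0 \<sigma>)"
      using False assms unfolding standard_brownian_motion_def \<sigma>_def by auto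
    have tr: "has_bochner_integral M (\<lambda>\<omega>. (X t \<omega> - X s \<omega>) ^ n) m"
      if "has_bochner_integral lborel (\<lambda>x. normal_density 0 \<sigma> x * (x - 0) ^ n) m" for n m
      using distributed_integral[OF D, of "\<lambda>x. x ^ n"] distributed_integrable[OF D, of "\<lambda>x. x ^ n"] that
      by (simp add: has_bochner_integral_iff)
    have "(t - s) = \<sigma>\<^sup>2" using \<sigma> by simp
    then show ?thesis
      using tr[OF normal_moment_odd[OF \<sigma>(1), of 0 0]] tr[OF normal_moment_even[OF \<sigma>(1), of 0 1]]
        tr[OF normal_moment_even[OF \<sigma>(1), of 0 2]]
      by (simp add: fact_numeral power_divide power_mult[symmetric])
  qed
  then show "has_bochner_integral M (\<lambda>\<omega>. X t \<omega> - X s \<omega>) 0"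
    and "has_bochner_integral M (\<lambda>\<omega>. (X t \<omega> - X s \<omega>)\<^sup>2) (t - s)"
    and "has_bochner_integral M (\<lambda>\<omega>. (X t \<omega> - X s \<omega>) ^ 4) (3 * (t - s)\<^sup>2)"
    by blast+
qed

lemma independent_increments_uncorrelated:
  assumes "prob_space M" and B2: "standard_brownian_motion M B2" and B3: "standard_brownian_motion M B3"
    and ind: "independent_processes M [B, B2, B3]" and st: "0 \<le> s" "s \<le> t"
  shows "has_bochner_integral M (\<lambda>\<omega>. (B2 t \<omega> - B2 s \<omega>) * (B3 t \<omega> - B3 s \<omega>)) 0"
proof -
  interpret prob_space M by fact
  define V where "V i \<omega> = ([B, B2, B3] ! i) t \<omega> - ([B, B2, B3] ! i) s \<omega>" for i \<omega>
  have len: "{..<length [B, B2, B3]} = {..<3}" by (simp add: numeral_3_eq_3)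
  have meas: "(\<lambda>f. f t - f s) \<in> borel_measurable (Pi\<^sub>M {0..} (\<lambda>_. borel :: real measure))"
    using st by (intro borel_measurable_diff measurable_component_singleton) auto
  have "indep_vars (\<lambda>_. borel) (\<lambda>i \<omega>. (\<lambda>f. f t - f s) (\<lambda>t\<in>{0..}. ([B, B2, B3] ! i) t \<omega>)) {..<3}"
    by (rule indep_vars_compose2[OF ind[unfolded independent_processes_def len] meas])
  then have "indep_vars (\<lambda>_. borel) V {..<3}"
    using st by (simp add: V_def[abs_def])
  then have iv: "indep_vars (\<lambda>_. borel) V {1, 2}" by (rule indep_vars_subset) auto
  have m: "has_bochner_integral M (V 1) 0" "has_bochner_integral M (V 2) 0"
    using brownian_increment_moments(1)[OF assms(1) B2 st] brownian_increment_moments(1)[OF assms(1) B3 st]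
    by (simp_all add: V_def[abs_def] numeral_2_eq_2)
  have "integrable M (V i)" if "i \<in> {1, 2}" for i
    using m that by (auto simp: has_bochner_integral_iff)
  from indep_vars_integrable[OF _ iv this] indep_vars_lebesgue_integral[OF _ iv this] m
  have "has_bochner_integral M (\<lambda>\<omega>. V 1 \<omega> * V 2 \<omega>) 0"
    by (simp add: has_bochner_integral_iff)
  then show ?thesis by (simp add: V_def numeral_2_eq_2)
qed

text \<open>The mean and the variance come from the coordinates separately; the pseudo-variance
  \<open>(E X\<^sup>2 - E Y\<^sup>2) / 2 + \<i> * E (X * Y)\<close> also needs the two coordinates to be uncorrelated.\<close>

lemma isotropic_noise_complex_noise:
  assumes "prob_space M" and B2: "standard_brownian_motion M B2" and B3: "standard_brownian_motion M B3"
    and ind: "independent_processes M [B, B2, B3]" and filt: "brownian_filtration M F B B2 B3"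
  shows "isotropic_noise M F (complex_noise B2 B3)"
proof -
  interpret prob_space M by fact
  have fil: "filtration (space M) F" and sub: "\<And>t. 0 \<le> t \<Longrightarrow> subalgebra M (F t)"
    and ad: "\<And>t. 0 \<le> t \<Longrightarrow> B2 t \<in> borel_measurable (F t)" "\<And>t. 0 \<le> t \<Longrightarrow> B3 t \<in> borel_measurable (F t)"
    and inc: "\<And>s t. 0 \<le> s \<Longrightarrow> s \<le> t \<Longrightarrow> indep_set (sets (F s))
          (sets (vimage_algebra (space M)
             (\<lambda>\<omega>. (B t \<omega> - B s \<omega>, B2 t \<omega> - B2 s \<omega>, B3 t \<omega> - B3 s \<omega>)) borel))"
    using filt unfolding brownian_filtration_def by blast+
  define X Y where "X s t \<omega> = B2 t \<omega> - B2 s \<omega>" and "Y s t \<omega> = B3 t \<omega> - B3 s \<omega>" for s t \<omega>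
  have W: "complex_noise B2 B3 t \<omega> - complex_noise B2 B3 s \<omega> =
      (of_real (X s t \<omega>) + \<i> * of_real (Y s t \<omega>)) / of_real (sqrt 2)" for s t \<omega>
    by (simp add: complex_noise_def X_def Y_def diff_divide_distrib[symmetric] algebra_simps)
  show ?thesis
  proof (unfold_locales, goal_cases)
    case (1 t)
    then show ?case by (rule sub)
  next
    case (2 s t)
    then show ?case
      using filtration.space_F[OF fil] filtration.sets_F_mono[OF fil] by (simp add: subalgebra_def)
  next
    case (3 t)
    note [measurable] = ad[OF 3]
    show ?case unfolding complex_noise_def[abs_def] by measurable
  next
    case (4 s t)
    define tr where "tr \<omega> = (B t \<omega> - B s \<omega>, X s t \<omega>, Y s t \<omega>)" for \<omega>
    \<comment> \<open>the increment of the complex noise is a function of the increments of the three Brownian motions\<close>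
    define f :: "real \<times> real \<times> real \<Rightarrow> complex" where
      "f p = (of_real (fst (snd p)) + \<i> * of_real (snd (snd p))) / of_real (sqrt 2)" for p
    have [measurable]: "f \<in> borel_measurable borel"
      unfolding f_def[abs_def] by (intro borel_measurable_continuous_onI continuous_intros) auto
    have "sets (vimage_algebra (space M) (\<lambda>\<omega>. complex_noise B2 B3 t \<omega> - complex_noise B2 B3 s \<omega>) borel)
       \<subseteq> sets (vimage_algebra (space M) tr borel)"
    proof
      fix A assume "A \<in> sets (vimage_algebra (space M) (\<lambda>\<omega>. complex_noise B2 B3 t \<omega> - complex_noise B2 B3 s \<omega>) borel)"
      then obtain S where S: "S \<in> sets borel" "A = (\<lambda>\<omega>. f (tr \<omega>)) -` S \<inter> space M"
        unfolding W f_def tr_def by (auto simp: sets_vimage_algebra2)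
      have "f -` S \<in> sets borel" using measurable_sets[OF \<open>f \<in> borel_measurable borel\<close> S(1)] by simp
      moreover have "A = tr -` (f -` S) \<inter> space M" using S(2) by auto
      ultimately show "A \<in> sets (vimage_algebra (space M) tr borel)"
        by (simp add: in_vimage_algebra)
    qed
    then show ?case
      using inc[OF 4] unfolding tr_def[abs_def] X_def Y_def indep_sets2_eq by blast
  next
    case (5 s t)
    have "has_bochner_integral M (\<lambda>\<omega>. (complex_of_real (X s t \<omega>) + \<i> * complex_of_real (Y s t \<omega>)) / of_real (sqrt 2))
        ((of_real 0 + \<i> * of_real 0) / of_real (sqrt 2))"
      unfolding X_def Y_def
      by (intro has_bochner_integral_divide has_bochner_integral_add has_bochner_integral_mult_right
          has_bochner_integral_of_real brownian_increment_moments(1) B2 B3 assms(1) 5; auto)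
    then show ?case unfolding W by simp
  next
    case (6 s t)
    have "has_bochner_integral M (\<lambda>\<omega>. complex_of_real (((X s t \<omega>)\<^sup>2 + (Y s t \<omega>)\<^sup>2) / 2))
        (of_real (((t - s) + (t - s)) / 2))"
      unfolding X_def Y_def
      by (intro has_bochner_integral_of_real has_bochner_integral_divide has_bochner_integral_add
          brownian_increment_moments(2) B2 B3 assms(1) 6; auto)
    moreover have eq: "(of_real x + \<i> * of_real y) / of_real (sqrt 2) * cnj ((of_real x + \<i> * of_real y) / of_real (sqrt 2))
        = complex_of_real ((x\<^sup>2 + y\<^sup>2) / 2)" for x y
      by (simp add: complex_eq_iff power2_eq_square field_simps)
    ultimately show ?case unfolding W eq by (simp only: field_sum_of_halves add_divide_distrib)
  next
    case (7 s t)
    have "has_bochner_integral M (\<lambda>\<omega>. complex_of_real (((X s t \<omega>)\<^sup>2 - (Y s t \<omega>)\<^sup>2) / 2)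
          + \<i> * complex_of_real (X s t \<omega> * Y s t \<omega>))
        (of_real (((t - s) - (t - s)) / 2) + \<i> * of_real 0)"
      unfolding X_def Y_def
      by (intro has_bochner_integral_of_real has_bochner_integral_divide has_bochner_integral_add
          has_bochner_integral_diff has_bochner_integral_mult_right
          brownian_increment_moments(2)[OF assms(1) B2 7] brownian_increment_moments(2)[OF assms(1) B3 7]
          independent_increments_uncorrelated[OF assms(1) B2 B3 ind 7])
    moreover have eq: "((of_real x + \<i> * of_real y) / of_real (sqrt 2))\<^sup>2
        = complex_of_real ((x\<^sup>2 - y\<^sup>2) / 2) + \<i> * complex_of_real (x * y)" for x y
      by (simp add: complex_eq_iff power2_eq_square field_simps)
    ultimately show ?case unfolding W eq by simp
  next
    case (8 s t)
    have m4: "has_bochner_integral M (\<lambda>\<omega>. ((X s t \<omega>) ^ 4 + (Y s t \<omega>) ^ 4) / 2) ((3 * (t - s)\<^sup>2 + 3 * (t - s)\<^sup>2) / 2)"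
      unfolding X_def Y_def
      by (intro has_bochner_integral_divide has_bochner_integral_add
          brownian_increment_moments(3) B2 B3 assms(1) 8; auto)
    have le: "norm ((of_real x + \<i> * of_real y) / of_real (sqrt 2)) ^ 4 \<le> (x ^ 4 + y ^ 4) / 2" for x y
    proof -
      have "(norm ((of_real x + \<i> * of_real y) / of_real (sqrt 2)))\<^sup>2 = (x\<^sup>2 + y\<^sup>2) / 2"
        by (simp add: norm_divide power_divide cmod_power2)
      then have "norm ((of_real x + \<i> * of_real y) / of_real (sqrt 2)) ^ 4 = ((x\<^sup>2 + y\<^sup>2) / 2)\<^sup>2"
        by (metis power_even_eq numeral_Bit0 mult_2)
      also have "\<dots> \<le> (x ^ 4 + y ^ 4) / 2"
        using sum_squares_bound[of "x\<^sup>2" "y\<^sup>2"] by (simp add: power_divide power2_sum field_simps)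
      finally show ?thesis .
    qed
    have [measurable]: "X s t \<in> borel_measurable M" "Y s t \<in> borel_measurable M"
      using brownian_increment_moments(1)[OF assms(1) B2 8] brownian_increment_moments(1)[OF assms(1) B3 8]
      unfolding X_def[abs_def] Y_def[abs_def] by (auto dest: borel_measurable_has_bochner_integral)
    have i: "integrable M (\<lambda>\<omega>. norm ((complex_of_real (X s t \<omega>) + \<i> * of_real (Y s t \<omega>)) / of_real (sqrt 2)) ^ 4)"
    proof (rule Bochner_Integration.integrable_bound[OF integrable.intros[OF m4]])
      show "(\<lambda>\<omega>. norm ((complex_of_real (X s t \<omega>) + \<i> * of_real (Y s t \<omega>)) / of_real (sqrt 2)) ^ 4) \<in> borel_measurable M"
        by measurable
      show "AE \<omega> in M. norm (norm ((complex_of_real (X s t \<omega>) + \<i> * of_real (Y s t \<omega>)) / of_real (sqrt 2)) ^ 4)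
          \<le> norm (((X s t \<omega>) ^ 4 + (Y s t \<omega>) ^ 4) / 2)"
        using le by (intro AE_I2) (simp add: order_trans[OF _ abs_ge_self])
    qed
    moreover have "expectation (\<lambda>\<omega>. norm ((complex_of_real (X s t \<omega>) + \<i> * of_real (Y s t \<omega>)) / of_real (sqrt 2)) ^ 4)
        \<le> expectation (\<lambda>\<omega>. ((X s t \<omega>) ^ 4 + (Y s t \<omega>) ^ 4) / 2)"
      using m4 by (intro integral_mono i le) (simp add: has_bochner_integral_iff)
    ultimately show ?case unfolding W using m4 by (simp add: has_bochner_integral_iff)
  qed
qed

section \<open>The event of two points\<close>

lemma real_analytic_on_isCont:
  assumes "real_analytic_on f UNIV"
  shows "isCont f x"
proof -
  from assms obtain r a where r: "0 < r" and a: "\<And>y. \<bar>y - x\<bar> < r \<Longrightarrow> (\<lambda>n. a n * (y - x) ^ n) sums f y"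
    unfolding real_analytic_on_def by blast
  have "isCont (\<lambda>h. \<Sum>n. a n * h ^ n) 0"
    using a[of "x + r / 2"] r by (intro isCont_powser[where K="r / 2"]) (auto simp: sums_iff)
  then have "isCont (\<lambda>y. \<Sum>n. a n * (y - x) ^ n) x"
    using isCont_o2[where f="\<lambda>y. y - x" and a=x and g="\<lambda>h. \<Sum>n. a n * h ^ n"] by simp
  moreover have "\<forall>\<^sub>F y in nhds x. (\<Sum>n. a n * (y - x) ^ n) = f y"
    unfolding eventually_nhds_metric using r a by (auto simp: dist_real_def sums_iff)
  ultimately show ?thesis using isCont_cong[of "\<lambda>y. \<Sum>n. a n * (y - x) ^ n" f x] by simp
qed

lemma count_ge_2_iff: "2 \<le> emeasure (count_space UNIV) S \<longleftrightarrow> (\<exists>x\<in>S. \<exists>y\<in>S. x \<noteq> y)"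
proof
  assume 2: "2 \<le> emeasure (count_space UNIV) S"
  show "\<exists>x\<in>S. \<exists>y\<in>S. x \<noteq> y"
  proof (rule ccontr)
    assume "\<not> ?thesis"
    then have "S = {} \<or> (\<exists>x. S = {x})" by blast
    then have "emeasure (count_space UNIV) S \<le> 1" by (auto simp: emeasure_count_space)
    then have "(2::ennreal) \<le> 1" using 2 by (rule order_trans[rotated])
    then show False by simp
  qed
next
  assume "\<exists>x\<in>S. \<exists>y\<in>S. x \<noteq> y"
  then obtain x y where "{x, y} \<subseteq> S" "x \<noteq> y" by blast
  then show "2 \<le> emeasure (count_space UNIV) S"
    using emeasure_mono[of "{x, y}" S "count_space UNIV"] by (simp add: emeasure_count_space)
qed

text \<open>Monotonicity makes distinct points have distinct multiples of \<open>2 * pi\<close>, so there are two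
  consecutive multiples between the phases at the ends; conversely the intermediate value theorem finds a
  point for each multiple. The right-hand side involves only the phases at \<open>a\<close> and \<open>b\<close>
  and is therefore measurable.\<close>

lemma Sch_count_ge_2_iff:
  assumes mono: "strict_mono (\<lambda>l. \<phi> l \<tau> \<omega>)" and cont: "\<And>l. isCont (\<lambda>l. \<phi> l \<tau> \<omega>) l"
    and \<tau>: "0 < \<tau>" and ab: "a \<le> b"
  shows "2 \<le> Sch_count \<phi> \<tau> \<omega> a b \<longleftrightarrow>
    (\<exists>k::int. \<phi> (a / \<tau>) \<tau> \<omega> \<le> 2 * pi * of_int k \<and> 2 * pi * (of_int k + 1) \<le> \<phi> (b / \<tau>) \<tau> \<omega>)"
proof -
  define f where "f l = \<phi> (l / \<tau>) \<tau> \<omega>" for l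
  have sm: "l < l' \<Longrightarrow> f l < f l'" for l l'
    using strict_monoD[OF mono, of "l / \<tau>" "l' / \<tau>"] \<tau> by (simp add: f_def divide_strict_right_mono)
  then have m: "l \<le> l' \<Longrightarrow> f l \<le> f l'" for l l' by (cases "l = l'") (auto simp: less_le intro: less_imp_le)
  have fc: "isCont f l" for l
    unfolding f_def[abs_def] using \<tau> by (intro isCont_o2[OF _ cont]) auto
  define P where "P l \<longleftrightarrow> (\<exists>k::int. f l = 2 * pi * of_int k)" for l
  have "2 \<le> Sch_count \<phi> \<tau> \<omega> a b \<longleftrightarrow> (\<exists>x\<in>Collect P \<inter> {a..b}. \<exists>y\<in>Collect P \<inter> {a..b}. x \<noteq> y)"
    unfolding Sch_count_def count_ge_2_iff Sch_def P_def f_def ..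
  also have "\<dots> \<longleftrightarrow> (\<exists>l l'. a \<le> l \<and> l < l' \<and> l' \<le> b \<and> P l \<and> P l')"
  proof
    assume "\<exists>x\<in>Collect P \<inter> {a..b}. \<exists>y\<in>Collect P \<inter> {a..b}. x \<noteq> y"
    then obtain x y where xy: "P x" "P y" "a \<le> x" "x \<le> b" "a \<le> y" "y \<le> b" "x \<noteq> y" by auto
    then consider "x < y" | "y < x" by linarith
    then show "\<exists>l l'. a \<le> l \<and> l < l' \<and> l' \<le> b \<and> P l \<and> P l'"
      using xy by cases blast+
  next
    assume "\<exists>l l'. a \<le> l \<and> l < l' \<and> l' \<le> b \<and> P l \<and> P l'"
    then obtain l l' where "a \<le> l" "l < l'" "l' \<le> b" "P l" "P l'" by blast
    then show "\<exists>x\<in>Collect P \<inter> {a..b}. \<exists>y\<in>Collect P \<inter> {a..b}. x \<noteq> y"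
      by (intro bexI[of _ l] bexI[of _ l']) auto
  qed
  also have "\<dots> \<longleftrightarrow> (\<exists>k::int. f a \<le> 2 * pi * of_int k \<and> 2 * pi * (of_int k + 1) \<le> f b)"
  proof (unfold P_def, safe)
    fix l l' and k k' :: int
    assume l: "a \<le> l" "l < l'" "l' \<le> b" "f l = 2 * pi * of_int k" "f l' = 2 * pi * of_int k'"
    have "2 * pi * of_int k < 2 * pi * of_int k'" using sm[OF l(2)] l by simp
    then have "k + 1 \<le> k'" by simp
    then have "real_of_int k + 1 \<le> of_int k'" by linarith
    then have "2 * pi * (of_int k + 1) \<le> 2 * pi * of_int k'"
      by (intro mult_left_mono) auto
    then show "\<exists>k::int. f a \<le> 2 * pi * of_int k \<and> 2 * pi * (of_int k + 1) \<le> f b"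
      using m[OF l(1)] m[OF l(3)] unfolding l(4,5) by (blast intro: order_trans)
  next
    fix k :: int
    assume k: "f a \<le> 2 * pi * of_int k" "2 * pi * (of_int k + 1) \<le> f b"
    have lt: "2 * pi * real_of_int k < 2 * pi * (of_int k + 1)" by simp
    have ivt: "\<exists>l\<ge>a. l \<le> b \<and> f l = y" if "f a \<le> y" "y \<le> f b" for y
      using IVT[OF that ab] fc by blast
    obtain l where l: "a \<le> l" "l \<le> b" "f l = 2 * pi * of_int k"
      using ivt[OF k(1) order_trans[OF less_imp_le[OF lt] k(2)]] by blast
    obtain l' where l': "a \<le> l'" "l' \<le> b" "f l' = 2 * pi * (of_int k + 1)"
      using ivt[OF order_trans[OF k(1) less_imp_le[OF lt]] k(2)] by blast
    have "l < l'"
    proof (rule ccontr)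
      assume "\<not> l < l'"
      then have "f l' \<le> f l" by (intro m) simp
      then show False using lt unfolding l(3) l'(3) by linarith
    qed
    moreover have "f l' = 2 * pi * of_int (k + 1)" unfolding l'(3) by simp
    ultimately show "\<exists>l l'. a \<le> l \<and> l < l' \<and> l' \<le> b \<and>
      (\<exists>k::int. f l = 2 * pi * of_int k) \<and> (\<exists>k::int. f l' = 2 * pi * of_int k)"
      using l l' by blast
  qed
  finally show ?thesis by (simp add: f_def)
qed

lemma (in prob_space) completion_event_AE:
  assumes A: "A \<in> events" and E: "E \<subseteq> space M" and eq: "AE \<omega> in M. \<omega> \<in> A \<longleftrightarrow> \<omega> \<in> E"
  shows "E \<in> sets (completion M)" "measure (completion M) E = prob A"
proof -
  from eq obtain N where N: "{\<omega>\<in>space M. \<not> (\<omega> \<in> A \<longleftrightarrow> \<omega> \<in> E)} \<subseteq> N" "N \<in> null_sets M"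
    by (auto elim!: AE_E intro: null_setsI)
  have AM: "A \<subseteq> space M" using A sets.sets_into_space by blast
  have EA: "E = (A - N) \<union> (E \<inter> N)" "E \<inter> N \<subseteq> N" using N(1) E AM by blast+
  show E_sets: "E \<in> sets (completion M)"
    by (rule sets_completionI[OF EA N(2)]) (use A N(2) in auto)
  show "measure (completion M) E = prob A"
  proof -
    have "AE \<omega> in completion M. \<omega> \<in> E \<longleftrightarrow> \<omega> \<in> A"
      using AE_completion[OF eq] by (rule eventually_mono) blast
    then show ?thesis
      using measure_eq_AE[of E A "completion M"] E_sets A by simp
  qed
qed

theorem theorem8:
  fixes M :: "'w measure" and F :: "real \<Rightarrow> 'w measure"
    and B B2 B3 :: "real \<Rightarrow> 'w \<Rightarrow> real"
    and \<phi> :: "real \<Rightarrow> real \<Rightarrow> 'w \<Rightarrow> real"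
    and \<tau> \<mu> \<epsilon> :: real
  assumes "prob_space M"
    and "standard_brownian_motion M B"
    and "standard_brownian_motion M B2"
    and "standard_brownian_motion M B3"
    and "independent_processes M [B, B2, B3]"
    and "brownian_filtration M F B B2 B3"
    and "\<And>l. phase_solution M F B (complex_noise B2 B3) l (\<phi> l)"
    and "\<And>t. t > 0 \<Longrightarrow> AE \<omega> in M. strict_mono (\<lambda>l. \<phi> l t \<omega>) \<and>
                                  real_analytic_on (\<lambda>l. \<phi> l t \<omega>) UNIV"
    and "\<tau> > 0" and "\<epsilon> > 0"
    and "ln (\<tau> / \<epsilon>) - \<tau> \<ge> 0"
  shows "two_points_event M \<phi> \<tau> \<mu> (\<mu> + \<epsilon>) \<in> sets (completion M) \<and>
         measure (completion M) (two_points_event M \<phi> \<tau> \<mu> (\<mu> + \<epsilon>))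
           \<le> 4 * exp (- ((ln (\<tau> / \<epsilon>) - \<tau>)\<^sup>2 / \<tau>))"
proof -
  interpret isotropic_noise M F "complex_noise B2 B3"
    by (rule isotropic_noise_complex_noise) fact+
  define \<delta> where "\<delta> = \<epsilon> / \<tau>"
  define \<theta>1 \<theta>2 where "\<theta>1 = \<phi> (\<mu> / \<tau>)" and "\<theta>2 = \<phi> ((\<mu> + \<epsilon>) / \<tau>)"
  have \<delta>: "0 < \<delta>" "(\<mu> + \<epsilon>) / \<tau> = \<mu> / \<tau> + \<delta>"
    using assms(9,10) by (auto simp: \<delta>_def add_divide_distrib)
  note sol = assms(7)[unfolded phase_solution_def]
  have pp: "phase_pair M F (complex_noise B2 B3) \<tau> \<delta> \<theta>1 \<theta>2"
  proof (unfold_locales, goal_cases)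
    case (4)
    show ?case using sol[of "\<mu> / \<tau>"] unfolding \<theta>1_def
      by (auto elim!: eventually_mono intro: continuous_on_subset)
  next
    case (5)
    show ?case using sol[of "(\<mu> + \<epsilon>) / \<tau>"] unfolding \<theta>2_def
      by (auto elim!: eventually_mono intro: continuous_on_subset)
  next
    case (6 t)
    obtain J1 J2 where J: "has_ito_integral M F (complex_noise B2 B3) t (\<lambda>s \<omega>. exp (- \<i> * complex_of_real (\<theta>1 s \<omega>))) J1"
      "AE \<omega> in M. \<theta>1 t \<omega> = \<mu> / \<tau> * t + B t \<omega> + Re (J1 \<omega>)"
      "has_ito_integral M F (complex_noise B2 B3) t (\<lambda>s \<omega>. exp (- \<i> * complex_of_real (\<theta>2 s \<omega>))) J2"
      "AE \<omega> in M. \<theta>2 t \<omega> = (\<mu> + \<epsilon>) / \<tau> * t + B t \<omega> + Re (J2 \<omega>)"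
      using sol[of "\<mu> / \<tau>"] sol[of "(\<mu> + \<epsilon>) / \<tau>"] 6 unfolding \<theta>1_def \<theta>2_def by blast
    have "AE \<omega> in M. \<theta>2 t \<omega> - \<theta>1 t \<omega> = \<delta> * t + Re (J2 \<omega> - J1 \<omega>)"
      using J(2,4) by eventually_elim (simp only: \<delta>(2), simp add: algebra_simps)
    with J show ?case by blast
  qed (use assms(9) sol[of "\<mu> / \<tau>"] sol[of "(\<mu> + \<epsilon>) / \<tau>"] in \<open>auto simp: \<theta>1_def \<theta>2_def\<close>)
  interpret phase_pair M F "complex_noise B2 B3" \<tau> \<delta> \<theta>1 \<theta>2 by (rule pp)
  define L where "L = ln (\<tau> / \<epsilon>)"
  have L: "ln \<delta> = - L" using assms(9,10) by (simp add: L_def \<delta>_def ln_div)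
  \<comment> \<open>the exponent that minimises \<open>(a\<^sup>2 / 4 + a) * \<tau> - a * L\<close>\<close>
  define a where "a = 2 * (L - \<tau>) / \<tau>"
  have a: "0 \<le> a" using assms(9,11) by (simp add: a_def L_def)
  define g where "g = saturated_power \<delta> a"
  obtain g1 g2 K where tf: "test_function g g1 g2 K \<delta> (a\<^sup>2 / 4 + a)"
    using saturated_power_test_function[OF \<delta>(1) a] unfolding g_def by blast
  interpret tf: test_function g g1 g2 K \<delta> "a\<^sup>2 / 4 + a" by (rule tf)
  have [measurable]: "\<theta>1 \<tau> \<in> borel_measurable M" "\<theta>2 \<tau> \<in> borel_measurable M"
    using F_measurable_M[OF _ adapted_phases(1)] F_measurable_M[OF _ adapted_phases(2)] assms(9) by auto
  define A where "A = {\<omega> \<in> space M. \<exists>k::int. \<theta>1 \<tau> \<omega> \<le> 2 * pi * of_int k \<and> 2 * pi * (of_int k + 1) \<le> \<theta>2 \<tau> \<omega>}"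
  have A: "A \<in> events" unfolding A_def by measurable
  have "AE \<omega> in M. \<omega> \<in> A \<longleftrightarrow> \<omega> \<in> two_points_event M \<phi> \<tau> \<mu> (\<mu> + \<epsilon>)"
    using assms(8)[OF assms(9)] AE_space
  proof eventually_elim
    case (elim \<omega>)
    then show ?case
      using Sch_count_ge_2_iff[of \<phi> \<tau> \<omega> \<mu> "\<mu> + \<epsilon>"] real_analytic_on_isCont assms(9,10)
      unfolding A_def two_points_event_def \<theta>1_def \<theta>2_def by simp
  qed
  note event = completion_event_AE[OF A _ this]
  have sub: "two_points_event M \<phi> \<tau> \<mu> (\<mu> + \<epsilon>) \<subseteq> space M" by (auto simp: two_points_event_def)
  have "prob A = expectation (indicator A)" using A by simp
  also have "\<dots> \<le> expectation (\<lambda>\<omega>. g (\<theta>2 \<tau> \<omega> - \<theta>1 \<tau> \<omega>))"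
  proof (rule integral_mono)
    show "integrable M (indicator A :: 'w \<Rightarrow> real)" using A by (simp add: integrable_indicator_iff less_top[symmetric])
    show "integrable M (\<lambda>\<omega>. g (\<theta>2 \<tau> \<omega> - \<theta>1 \<tau> \<omega>))"
      using tf.bounded_test(1) by (intro integrable_const_bound[where B=K]) auto
    show "indicator A \<omega> \<le> g (\<theta>2 \<tau> \<omega> - \<theta>1 \<tau> \<omega>)" for \<omega>
    proof (cases "\<omega> \<in> A")
      case True
      then have "2 * pi \<le> \<theta>2 \<tau> \<omega> - \<theta>1 \<tau> \<omega>" by (auto simp: A_def algebra_simps)
      then show ?thesis using saturated_power_ge_1[OF a] True by (simp add: g_def)
    qed (simp add: tf.test_nonneg)
  qed
  also have "\<dots> \<le> exp ((a\<^sup>2 / 4 + a) * \<tau>) * g 0" by (rule dynkin_inequality[OF tf])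
  also have "\<dots> \<le> exp ((a\<^sup>2 / 4 + a) * \<tau>) * exp (a * ln \<delta>)"
    unfolding g_def by (intro mult_left_mono saturated_power_0 \<delta>(1) a) auto
  also have "\<dots> = exp (- ((L - \<tau>)\<^sup>2 / \<tau>))"
  proof -
    have "(a\<^sup>2 / 4 + a) * \<tau> + a * (- L) = - ((L - \<tau>)\<^sup>2 / \<tau>)"
      using assms(9) unfolding a_def by (simp add: field_simps power2_eq_square)
    then show ?thesis unfolding L exp_add[symmetric] by simp
  qed
  also have "\<dots> \<le> 4 * exp (- ((L - \<tau>)\<^sup>2 / \<tau>))" by simp
  finally show ?thesis using event[OF sub] unfolding L_def by simp
qed

end
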